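(* Let $T$ be a countable complete theory with monster model $\mathcal{U}$. Let $\mu\in\mathfrak{M}_x(\mathcal{U})$ and $\nu\in\mathfrak{M}_y(\mathcal{U})$ be Keisler measures. If $\mu$ is sequentially approximated and $\nu$ is definable, then $\mu\otimes\nu=\nu\otimes\mu$ (as measures in $\mathfrak{M}_{x,y}(\mathcal{U})$).
   Context: $T$ is a complete first-order theory in a countable language $\mathcal{L}$, $\mathcal{U}$ is a monster model (sufficiently saturated and strongly homogeneous), "small" means of cardinality smaller than the degree of saturation, $x$ and $y$ are disjoint finite tuples of variables. $\mathfrak{M}_x(A)$ is the space of Keisler measures over $A$, i.e. finitely additive probability measures on the Boolean algebra $\mathcal{L}_x(A)$ of formulas in $x$ with parameters from $A$, with the topology of pointwise convergence on formulas. For $\overline{a}=(a_1,\dots,a_n)$, $\operatorname{Av}(\overline{a})(\psi(x))=\frac1n|\{1\le i\le n:\mathcal{U}\models\psi(a_i)\}|$. $\mu$ is sequentially approximated if there are a small $M\prec\mathcal{U}$ and a sequence $(\overline{a}_i)_{i\in\omega}$ in $(M^x)^{<\omega}$ (finite sequences of points of $M^x$) with $\lim_{i\to\infty}\operatorname{Av}(\overline{a}_i)=\mu$ in $\mathfrak{M}_x(\mathcal{U})$. $\mu$ is $M$-invariant if for every $\mathcal{L}$-formula $\varphi(x,y)$ and $b\equiv_M b'$ in $\mathcal{U}^y$, $\mu(\varphi(x,b))=\mu(\varphi(x,b'))$; then for $\varphi(x,y)\in\mathcal{L}_{x,y}(M)$ one defines $F_\mu^\varphi:S_y(M)\to[0,1]$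 by $F_\mu^\varphi(q)=\mu(\varphi(x,b))$ for any $b\models q$. A measure is Borel-definable (resp. definable) if there is a small model $M$ such that it is $M$-invariant and all the maps $F_\mu^\varphi$ on $S_y(M)$ for $\mathcal{L}$-formulas $\varphi(x,y)$ are Borel (resp. continuous). Sequentially approximated measures are Borel-definable. Morley product: if $\mu$ is Borel-definable over $M$, $\mu\otimes\nu\in\mathfrak{M}_{x,y}(\mathcal{U})$ is given, for $\varphi(x,y)\in\mathcal{L}_{x,y}(\mathcal{U})$, by $\mu\otimes\nu(\varphi(x,y))=\int_{S_y(N)}F_\mu^\varphi\,d(\nu|_N)$, where $N\prec\mathcal{U}$ is any small model containing $M$ and the parameters of $\varphi$, $F_\mu^\varphi$ is taken over $N$, and $\nu|_N$ is identified with the associated regular Borel probability measure on $S_y(N)$; this does not depend on $N$. Symmetrically, $\nu\otimes\mu(\varphi(x,y))=\int_{S_x(N)}F_\nu^{\varphi^*}\,d(\mu|_N)$, where $\varphi^*(y,x)$ is the same formula with roles of object and parameter variables exchanged. *)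

theory Defs
  imports "HOL-Probability.Probability"
begin

unbundle cardinal_syntax

section \<open>First-order logic with parameters\<close>

text \<open>A language is a set of function symbols (constants being the 0-ary ones) and a set of
  relation symbols, with arities. A structure, here always one whose universe is the whole type
  \<open>'a\<close>, carries its language with it.\<close>

record ('f, 'r) lang =
  funs :: "'f set"
  farity :: "'f \<Rightarrow> nat"
  rels :: "'r set"
  rarity :: "'r \<Rightarrow> nat"

record ('f, 'r, 'a) struct = "('f, 'r) lang" +
  fun_int :: "'f \<Rightarrow> 'a list \<Rightarrow> 'a"
  rel_int :: "'r \<Rightarrow> 'a list \<Rightarrow> bool"

definition countable_lang :: "('f, 'r, 'z) lang_scheme \<Rightarrow> bool" where
  "countable_lang L \<longleftrightarrow> countable (funs L) \<and> countable (rels L)"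

text \<open>\<open>Par a\<close> is the name of the element \<open>a\<close>; a formula over the bare language is one
  with \<open>params \<phi> = {}\<close>.\<close>

datatype (dead 'f, tm_params: 'a) tm =
  Var nat | Par 'a | Fn 'f "('f, 'a) tm list"

datatype (dead 'f, dead 'r, params: 'a) fm =
  Eq "('f, 'a) tm" "('f, 'a) tm"
| Rel 'r "('f, 'a) tm list"
| Neg "('f, 'r, 'a) fm"
| Conj "('f, 'r, 'a) fm" "('f, 'r, 'a) fm"
| Ex nat "('f, 'r, 'a) fm"

primrec tm_fv :: "('f, 'a) tm \<Rightarrow> nat set" where
  "tm_fv (Var v) = {v}"
| "tm_fv (Par a) = {}"
| "tm_fv (Fn f ts) = \<Union> (set (map tm_fv ts))"

primrec fv :: "('f, 'r, 'a) fm \<Rightarrow> nat set" where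
  "fv (Eq s t) = tm_fv s \<union> tm_fv t"
| "fv (Rel r ts) = \<Union> (set (map tm_fv ts))"
| "fv (Neg \<phi>) = fv \<phi>"
| "fv (Conj \<phi> \<psi>) = fv \<phi> \<union> fv \<psi>"
| "fv (Ex v \<phi>) = fv \<phi> - {v}"

primrec wf_tm :: "('f, 'r, 'z) lang_scheme \<Rightarrow> ('f, 'a) tm \<Rightarrow> bool" where
  "wf_tm L (Var v) \<longleftrightarrow> True"
| "wf_tm L (Par a) \<longleftrightarrow> True"
| "wf_tm L (Fn f ts) \<longleftrightarrow> f \<in> funs L \<and> length ts = farity L f \<and> list_all id (map (wf_tm L) ts)"

primrec wf_fm :: "('f, 'r, 'z) lang_scheme \<Rightarrow> ('f, 'r, 'a) fm \<Rightarrow> bool" where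
  "wf_fm L (Eq s t) \<longleftrightarrow> wf_tm L s \<and> wf_tm L t"
| "wf_fm L (Rel r ts) \<longleftrightarrow> r \<in> rels L \<and> length ts = rarity L r \<and> list_all (wf_tm L) ts"
| "wf_fm L (Neg \<phi>) \<longleftrightarrow> wf_fm L \<phi>"
| "wf_fm L (Conj \<phi> \<psi>) \<longleftrightarrow> wf_fm L \<phi> \<and> wf_fm L \<psi>"
| "wf_fm L (Ex v \<phi>) \<longleftrightarrow> wf_fm L \<phi>"

primrec eval_tm :: "('f, 'r, 'a) struct \<Rightarrow> (nat \<Rightarrow> 'a) \<Rightarrow> ('f, 'a) tm \<Rightarrow> 'a" where
  "eval_tm U e (Var v) = e v"
| "eval_tm U e (Par a) = a"
| "eval_tm U e (Fn f ts) = fun_int U f (map (eval_tm U e) ts)"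

text \<open>\<open>sat_in U M e \<phi>\<close> is satisfaction in the substructure of \<open>U\<close> with universe \<open>M\<close>.\<close>

primrec sat_in ::
  "('f, 'r, 'a) struct \<Rightarrow> 'a set \<Rightarrow> (nat \<Rightarrow> 'a) \<Rightarrow> ('f, 'r, 'a) fm \<Rightarrow> bool" where
  "sat_in U M e (Eq s t) \<longleftrightarrow> eval_tm U e s = eval_tm U e t"
| "sat_in U M e (Rel r ts) \<longleftrightarrow> rel_int U r (map (eval_tm U e) ts)"
| "sat_in U M e (Neg \<phi>) \<longleftrightarrow> \<not> sat_in U M e \<phi>"
| "sat_in U M e (Conj \<phi> \<psi>) \<longleftrightarrow> sat_in U M e \<phi> \<and> sat_in U M e \<psi>"
| "sat_in U M e (Ex v \<phi>) \<longleftrightarrow> (\<exists>a\<in>M. sat_in U M (e(v := a)) \<phi>)"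

abbreviation sat :: "('f, 'r, 'a) struct \<Rightarrow> (nat \<Rightarrow> 'a) \<Rightarrow> ('f, 'r, 'a) fm \<Rightarrow> bool" where
  "sat U \<equiv> sat_in U UNIV"

text \<open>Truth of the universal closure; for sentences, simply truth in \<open>U\<close>.\<close>

definition holds :: "('f, 'r, 'a) struct \<Rightarrow> ('f, 'r, 'a) fm \<Rightarrow> bool" where
  "holds U \<phi> \<longleftrightarrow> (\<forall>e. sat U e \<phi>)"

primrec subst_tm :: "(nat \<Rightarrow> 'a option) \<Rightarrow> ('f, 'a) tm \<Rightarrow> ('f, 'a) tm" where
  "subst_tm s (Var v) = (case s v of None \<Rightarrow> Var v | Some a \<Rightarrow> Par a)"
| "subst_tm s (Par a) = Par a"
| "subst_tm s (Fn f ts) = Fn f (map (subst_tm s) ts)"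

primrec subst :: "('f, 'r, 'a) fm \<Rightarrow> (nat \<Rightarrow> 'a option) \<Rightarrow> ('f, 'r, 'a) fm" where
  "subst (Eq t u) s = Eq (subst_tm s t) (subst_tm s u)"
| "subst (Rel r ts) s = Rel r (map (subst_tm s) ts)"
| "subst (Neg \<phi>) s = Neg (subst \<phi> s)"
| "subst (Conj \<phi> \<psi>) s = Conj (subst \<phi> s) (subst \<psi> s)"
| "subst (Ex v \<phi>) s = Ex v (subst \<phi> (s(v := None)))"

text \<open>\<open>inst y b \<phi>\<close> is the formula \<open>\<phi>(b)\<close>, respectively \<open>\<phi>(x, b)\<close>: the tuple of parameters
  \<open>b\<close> is substituted for the tuple of variables \<open>y\<close>.\<close>

definition inst :: "nat list \<Rightarrow> 'a list \<Rightarrow> ('f, 'r, 'a) fm \<Rightarrow> ('f, 'r, 'a) fm" where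
  "inst y b \<phi> = subst \<phi> (map_of (zip y b))"

text \<open>\<open>forms L x A\<close> is \<open>L\<^sub>x(A)\<close>. The tuple \<open>x\<close> only matters through its set of variables, so
  that \<open>forms L (x @ y) A = forms L (y @ x) A\<close>.\<close>

definition forms :: "('f, 'r, 'z) lang_scheme \<Rightarrow> nat list \<Rightarrow> 'a set \<Rightarrow> ('f, 'r, 'a) fm set" where
  "forms L x A = {\<phi>. wf_fm L \<phi> \<and> fv \<phi> \<subseteq> set x \<and> params \<phi> \<subseteq> A}"

definition tuples :: "nat list \<Rightarrow> 'a set \<Rightarrow> 'a list set" where
  "tuples x A = {a. length a = length x \<and> set a \<subseteq> A}"

section \<open>Theories, types and monster models\<close>

text \<open>A complete theory is taken to be closed under consequence, i.e. it decides every sentence by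
  membership. Consistency comes from having a model.\<close>

definition complete_theory :: "('f, 'r, 'z) lang_scheme \<Rightarrow> ('f, 'r, 'a) fm set \<Rightarrow> bool" where
  "complete_theory L T \<longleftrightarrow>
     T \<subseteq> forms L [] {} \<and> (\<forall>\<sigma>\<in>forms L [] {}. \<sigma> \<in> T \<or> Neg \<sigma> \<in> T)"

definition models :: "('f, 'r, 'a) struct \<Rightarrow> ('f, 'r, 'a) fm set \<Rightarrow> bool" where
  "models U T \<longleftrightarrow> (\<forall>\<sigma>\<in>T. holds U \<sigma>)"

definition elem_sub :: "('f, 'r, 'a) struct \<Rightarrow> 'a set \<Rightarrow> bool" where
  "elem_sub U M \<longleftrightarrow> M \<noteq> {} \<and>
     (\<forall>f\<in>funs U. \<forall>as. length as = farity U f \<and> set as \<subseteq> M \<longrightarrow> fun_int U f as \<in> M) \<and>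
     (\<forall>\<phi> e. wf_fm U \<phi> \<and> params \<phi> = {} \<and> range e \<subseteq> M \<longrightarrow>
        (sat_in U M e \<phi> \<longleftrightarrow> sat U e \<phi>))"

text \<open>\<open>S\<^sub>x(A)\<close>: the maximal sets of formulas over \<open>A\<close> that are finitely satisfiable in \<open>U\<close>.\<close>

definition types :: "('f, 'r, 'a) struct \<Rightarrow> nat list \<Rightarrow> 'a set \<Rightarrow> ('f, 'r, 'a) fm set set" where
  "types U x A = {p. p \<subseteq> forms U x A \<and>
     (\<forall>P. finite P \<and> P \<subseteq> p \<longrightarrow> (\<exists>e. \<forall>\<phi>\<in>P. sat U e \<phi>)) \<and>
     (\<forall>\<phi>\<in>forms U x A. \<phi> \<in> p \<or> Neg \<phi> \<in> p)}"

definition tp :: "('f, 'r, 'a) struct \<Rightarrow> nat list \<Rightarrow> 'a set \<Rightarrow> 'a list \<Rightarrow> ('f, 'r, 'a) fm set" where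
  "tp U x A b = {\<phi> \<in> forms U x A. holds U (inst x b \<phi>)}"

definition realizes :: "('f, 'r, 'a) struct \<Rightarrow> nat list \<Rightarrow> 'a list \<Rightarrow> ('f, 'r, 'a) fm set \<Rightarrow> bool" where
  "realizes U x b p \<longleftrightarrow> b \<in> tuples x UNIV \<and> (\<forall>\<phi>\<in>p. holds U (inst x b \<phi>))"

definition type_cyl ::
  "('f, 'r, 'a) struct \<Rightarrow> nat list \<Rightarrow> 'a set \<Rightarrow> ('f, 'r, 'a) fm \<Rightarrow> ('f, 'r, 'a) fm set set" where
  "type_cyl U x A \<phi> = {p \<in> types U x A. \<phi> \<in> p}"

definition type_space ::
  "('f, 'r, 'a) struct \<Rightarrow> nat list \<Rightarrow> 'a set \<Rightarrow> ('f, 'r, 'a) fm set topology" where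
  "type_space U x A = topology_generated_by (type_cyl U x A ` forms U x A)"

definition automorphism :: "('f, 'r, 'a) struct \<Rightarrow> ('a \<Rightarrow> 'a) \<Rightarrow> bool" where
  "automorphism U g \<longleftrightarrow> bij g \<and>
     (\<forall>f\<in>funs U. \<forall>as. length as = farity U f \<longrightarrow> g (fun_int U f as) = fun_int U f (map g as)) \<and>
     (\<forall>r\<in>rels U. \<forall>as. length as = rarity U r \<longrightarrow> rel_int U r (map g as) = rel_int U r as)"

definition saturated :: "'k rel \<Rightarrow> ('f, 'r, 'a) struct \<Rightarrow> bool" where
  "saturated \<kappa> U \<longleftrightarrow> (\<forall>A x p. |A| <o \<kappa> \<and> distinct x \<and> p \<in> types U x A \<longrightarrow> (\<exists>b. realizes U x b p))"

definition elementary_map :: "('f, 'r, 'a) struct \<Rightarrow> 'a set \<Rightarrow> ('a \<Rightarrow> 'a) \<Rightarrow> bool" where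
  "elementary_map U A f \<longleftrightarrow> (\<forall>\<sigma>\<in>forms U [] A. holds U (map_fm f \<sigma>) \<longleftrightarrow> holds U \<sigma>)"

definition strongly_homogeneous :: "'k rel \<Rightarrow> ('f, 'r, 'a) struct \<Rightarrow> bool" where
  "strongly_homogeneous \<kappa> U \<longleftrightarrow>
     (\<forall>A f. |A| <o \<kappa> \<and> elementary_map U A f \<longrightarrow> (\<exists>g. automorphism U g \<and> (\<forall>a\<in>A. g a = f a)))"

text \<open>The degree \<open>\<kappa>\<close> of saturation is any uncountable cardinal (a well-order in the sense of
  \<open>Card_order\<close>, possibly on another type). Small means of cardinality less than \<open>\<kappa>\<close>.\<close>

definition monster_model :: "'k rel \<Rightarrow> ('f, 'r, 'a) fm set \<Rightarrow> ('f, 'r, 'a) struct \<Rightarrow> bool" where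
  "monster_model \<kappa> T U \<longleftrightarrow> Card_order \<kappa> \<and> natLeq <o \<kappa> \<and>
     models U T \<and> saturated \<kappa> U \<and> strongly_homogeneous \<kappa> U"

definition small_model :: "'k rel \<Rightarrow> ('f, 'r, 'a) struct \<Rightarrow> 'a set \<Rightarrow> bool" where
  "small_model \<kappa> U M \<longleftrightarrow> elem_sub U M \<and> |M| <o \<kappa>"

section \<open>Keisler measures\<close>

text \<open>Keisler measures are functions on formulas, \<open>undefined\<close> outside \<open>L\<^sub>x(A)\<close>. The Boolean
  algebra \<open>L\<^sub>x(A)\<close> consists of formulas modulo equivalence in \<open>U\<close>, hence the requirement that
  equivalent formulas have equal measure. In the additivity clause \<open>\<phi> \<or> \<psi>\<close> is written through
  negation and conjunction.\<close>

definition keisler :: "('f, 'r, 'a) struct \<Rightarrow> nat list \<Rightarrow> 'a set \<Rightarrow> (('f, 'r, 'a) fm \<Rightarrow> real) set" where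
  "keisler U x A = {\<mu> \<in> extensional (forms U x A).
     (\<forall>\<phi>\<in>forms U x A. 0 \<le> \<mu> \<phi>) \<and>
     (\<forall>\<phi>\<in>forms U x A. holds U \<phi> \<longrightarrow> \<mu> \<phi> = 1) \<and>
     (\<forall>\<phi>\<in>forms U x A. \<forall>\<psi>\<in>forms U x A. (\<forall>e. sat U e \<phi> \<longleftrightarrow> sat U e \<psi>) \<longrightarrow> \<mu> \<phi> = \<mu> \<psi>) \<and>
     (\<forall>\<phi>\<in>forms U x A. \<forall>\<psi>\<in>forms U x A. (\<forall>e. \<not> (sat U e \<phi> \<and> sat U e \<psi>)) \<longrightarrow>
        \<mu> (Neg (Conj (Neg \<phi>) (Neg \<psi>))) = \<mu> \<phi> + \<mu> \<psi>)}"

definition keisler_space ::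
  "('f, 'r, 'a) struct \<Rightarrow> nat list \<Rightarrow> 'a set \<Rightarrow> (('f, 'r, 'a) fm \<Rightarrow> real) topology" where
  "keisler_space U x A =
     subtopology (product_topology (\<lambda>_. euclideanreal) (forms U x A)) (keisler U x A)"

definition Av :: "('f, 'r, 'a) struct \<Rightarrow> nat list \<Rightarrow> 'a list list \<Rightarrow> ('f, 'r, 'a) fm \<Rightarrow> real" where
  "Av U x as = (\<lambda>\<psi>\<in>forms U x UNIV.
     real (card {i. i < length as \<and> holds U (inst x (as ! i) \<psi>)}) / real (length as))"

definition sequentially_approximated ::
  "'k rel \<Rightarrow> ('f, 'r, 'a) struct \<Rightarrow> nat list \<Rightarrow> (('f, 'r, 'a) fm \<Rightarrow> real) \<Rightarrow> bool" where
  "sequentially_approximated \<kappa> U x \<mu> \<longleftrightarrow> (\<exists>M a. small_model \<kappa> U M \<and>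
     (\<forall>i::nat. a i \<noteq> [] \<and> set (a i) \<subseteq> tuples x M) \<and>
     limitin (keisler_space U x UNIV) (\<lambda>i. Av U x (a i)) \<mu> sequentially)"

text \<open>In the notions below the object variables \<open>x\<close> are fixed, while the parameter variables \<open>y\<close>
  range over all finite tuples disjoint from \<open>x\<close>.\<close>

definition invariant ::
  "('f, 'r, 'a) struct \<Rightarrow> nat list \<Rightarrow> 'a set \<Rightarrow> (('f, 'r, 'a) fm \<Rightarrow> real) \<Rightarrow> bool" where
  "invariant U x M \<mu> \<longleftrightarrow> (\<forall>y \<phi> b b'. distinct y \<and> set x \<inter> set y = {} \<and>
     \<phi> \<in> forms U (x @ y) {} \<and> b \<in> tuples y UNIV \<and> b' \<in> tuples y UNIV \<and> tp U y M b = tp U y M b' \<longrightarrow>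
     \<mu> (inst y b \<phi>) = \<mu> (inst y b' \<phi>))"

text \<open>\<open>F\<^sub>\<mu>\<^sup>\<phi>\<close> for \<open>\<phi>(x, y)\<close>, where \<open>y\<close> is given. The choice of the realization is immaterial
  when \<open>\<mu>\<close> is invariant over a model containing the parameters of \<open>\<phi>\<close>.\<close>

definition fiber ::
  "('f, 'r, 'a) struct \<Rightarrow> nat list \<Rightarrow> (('f, 'r, 'a) fm \<Rightarrow> real) \<Rightarrow> ('f, 'r, 'a) fm \<Rightarrow>
   ('f, 'r, 'a) fm set \<Rightarrow> real" where
  "fiber U y \<mu> \<phi> q = \<mu> (inst y (SOME b. realizes U y b q) \<phi>)"

definition borel_sets :: "'b topology \<Rightarrow> 'b measure" where
  "borel_sets X = sigma (topspace X) {G. openin X G}"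

definition borel_definable_over ::
  "'k rel \<Rightarrow> ('f, 'r, 'a) struct \<Rightarrow> nat list \<Rightarrow> 'a set \<Rightarrow> (('f, 'r, 'a) fm \<Rightarrow> real) \<Rightarrow> bool" where
  "borel_definable_over \<kappa> U x M \<mu> \<longleftrightarrow> small_model \<kappa> U M \<and> invariant U x M \<mu> \<and>
     (\<forall>y \<phi>. distinct y \<and> set x \<inter> set y = {} \<and> \<phi> \<in> forms U (x @ y) {} \<longrightarrow>
        fiber U y \<mu> \<phi> \<in> borel_measurable (borel_sets (type_space U y M)))"

definition definable_over ::
  "'k rel \<Rightarrow> ('f, 'r, 'a) struct \<Rightarrow> nat list \<Rightarrow> 'a set \<Rightarrow> (('f, 'r, 'a) fm \<Rightarrow> real) \<Rightarrow> bool" where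
  "definable_over \<kappa> U x M \<mu> \<longleftrightarrow> small_model \<kappa> U M \<and> invariant U x M \<mu> \<and>
     (\<forall>y \<phi>. distinct y \<and> set x \<inter> set y = {} \<and> \<phi> \<in> forms U (x @ y) {} \<longrightarrow>
        continuous_map (type_space U y M) euclideanreal (fiber U y \<mu> \<phi>))"

definition definable ::
  "'k rel \<Rightarrow> ('f, 'r, 'a) struct \<Rightarrow> nat list \<Rightarrow> (('f, 'r, 'a) fm \<Rightarrow> real) \<Rightarrow> bool" where
  "definable \<kappa> U x \<mu> \<longleftrightarrow> (\<exists>M. definable_over \<kappa> U x M \<mu>)"

section \<open>The Morley product\<close>

definition regular_borel_prob :: "'b topology \<Rightarrow> 'b measure \<Rightarrow> bool" where
  "regular_borel_prob X m \<longleftrightarrow> sets m = sets (borel_sets X) \<and> prob_space m \<and>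
     (\<forall>B\<in>sets m. \<forall>\<epsilon>>0. \<exists>C G. closedin X C \<and> openin X G \<and> C \<subseteq> B \<and> B \<subseteq> G \<and> measure m (G - C) < \<epsilon>)"

text \<open>The regular Borel probability measure on \<open>S\<^sub>y(N)\<close> associated with \<open>\<nu>|\<^sub>N\<close>.\<close>

definition type_measure ::
  "('f, 'r, 'a) struct \<Rightarrow> nat list \<Rightarrow> 'a set \<Rightarrow> (('f, 'r, 'a) fm \<Rightarrow> real) \<Rightarrow>
   ('f, 'r, 'a) fm set measure" where
  "type_measure U y N \<nu> = (THE m. regular_borel_prob (type_space U y N) m \<and>
     (\<forall>\<phi>\<in>forms U y N. measure m (type_cyl U y N \<phi>) = \<nu> \<phi>))"

text \<open>The small model \<open>N\<close> used for \<open>\<phi>\<close> is chosen arbitrarily; when \<open>\<mu>\<close> is Borel-definable, one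
  exists and the integral does not depend on it.\<close>

definition morley_product ::
  "'k rel \<Rightarrow> ('f, 'r, 'a) struct \<Rightarrow> nat list \<Rightarrow> nat list \<Rightarrow> (('f, 'r, 'a) fm \<Rightarrow> real) \<Rightarrow>
   (('f, 'r, 'a) fm \<Rightarrow> real) \<Rightarrow> ('f, 'r, 'a) fm \<Rightarrow> real" where
  "morley_product \<kappa> U x y \<mu> \<nu> = (\<lambda>\<phi>\<in>forms U (x @ y) UNIV.
     let N = (SOME N. small_model \<kappa> U N \<and> params \<phi> \<subseteq> N \<and>
                (\<exists>M\<subseteq>N. borel_definable_over \<kappa> U x M \<mu>))
     in \<integral>q. fiber U y \<mu> \<phi> q \<partial>type_measure U y N \<nu>)"

end

theory Submission
  imports Defs
begin

text \<open>Let \<open>M\<close> be a small model containing points \<open>a\<^sub>i\<^sub>,\<^sub>j\<close> whose averages converge to \<open>\<mu>\<close>, a small set over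
which \<open>\<nu>\<close> is definable, and the parameters of \<open>\<phi>(x, y)\<close>. Both sides of the identity are then the
limit over \<open>i\<close> of the average over \<open>j\<close> of the numbers \<open>\<nu>(\<phi>(a\<^sub>i\<^sub>,\<^sub>j, y))\<close>.

For \<open>\<mu> \<otimes> \<nu>\<close>: the fiber of \<open>\<mu>\<close> at a type \<open>q\<close> is the pointwise limit of the frequency of those \<open>j\<close>
with \<open>\<phi>(a\<^sub>i\<^sub>,\<^sub>j, y) \<in> q\<close>. This frequency is an average of indicators of clopen sets, its integral
against \<open>\<nu>\<close> is the average of the \<open>\<nu>(\<phi>(a\<^sub>i\<^sub>,\<^sub>j, y))\<close>, and dominated convergence applies because only a
sequence, not a net, is involved (\<open>avg_tends_to_fiber_integral\<close>).

For \<open>\<nu> \<otimes> \<mu>\<close>: the value of the fiber of \<open>\<nu>\<close> at the type of \<open>a\<^sub>i\<^sub>,\<^sub>j\<close> is \<open>\<nu>(\<phi>(a\<^sub>i\<^sub>,\<^sub>j, y))\<close>. The fiber is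
continuous by definability, hence a uniform limit of step functions over clopen sets, and on clopen
sets the averages converge to \<open>\<mu>\<close> by hypothesis; so the averages of the fiber converge to its
integral (\<open>avg_continuous_tends_to_integral\<close>).

To turn this into a statement about \<open>morley_product\<close>, three facts are needed. A Keisler measure
has exactly one regular Borel extension to the type space, by a Caratheodory argument on an
arbitrary compact space with a basis of clopen sets (\<open>type_measure_spec\<close>). The integral does not
depend on the small model: the measure on \<open>S\<^sub>y(N)\<close> is the image of the one on \<open>S\<^sub>y(N')\<close> under
restriction of types, for \<open>N \<subseteq> N'\<close>, and fibers are compatible with restriction
(\<open>fiber_integral_indep\<close>). Finally any small set lies in a small elementary submodel, by the downward
Loewenheim-Skolem construction (\<open>small_model_above\<close>); so the two models chosen in the two products
and the model \<open>M\<close> above can be replaced by one common model.\<close>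

section \<open>Regular Borel measures on compact spaces with a clopen basis\<close>

lemma space_borel_sets [simp]: "space (borel_sets X) = topspace X"
  by (simp add: borel_sets_def space_measure_of_conv)

lemma sets_borel_sets: "sets (borel_sets X) = sigma_sets (topspace X) {G. openin X G}"
  unfolding borel_sets_def by (intro sets_measure_of) (auto dest: openin_subset)

lemma openin_in_borel_sets [intro]: "openin X G \<Longrightarrow> G \<in> sets (borel_sets X)"
  by (simp add: sets_borel_sets)

lemma continuous_map_measurable_borel_sets:
  assumes "continuous_map X Y f"
  shows "f \<in> measurable (borel_sets X) (borel_sets Y)"
  unfolding borel_sets_def[of Y]
proof (rule measurable_sigma_sets[OF sets_measure_of])
  show "f -` G \<inter> space (borel_sets X) \<in> sets (borel_sets X)" if "G \<in> {G. openin Y G}" for G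
  proof -
    have "f -` G \<inter> space (borel_sets X) = {p \<in> topspace X. f p \<in> G}" by auto
    then show ?thesis
      using that assms by (auto intro: openin_in_borel_sets simp: openin_continuous_map_preimage)
  qed
qed (use assms in \<open>auto dest: openin_subset continuous_map_funspace\<close>)

lemma continuous_map_real_measurable_borel_sets:
  fixes f :: "'b \<Rightarrow> real"
  assumes "continuous_map X euclideanreal f"
  shows "f \<in> borel_measurable (borel_sets X)"
proof (rule borel_measurableI)
  fix S :: "real set" assume "open S"
  then have "openin X {p \<in> topspace X. f p \<in> S}"
    using assms by (auto intro: openin_continuous_map_preimage)
  moreover have "f -` S \<inter> space (borel_sets X) = {p \<in> topspace X. f p \<in> S}" by auto
  ultimately show "f -` S \<inter> space (borel_sets X) \<in> sets (borel_sets X)" by auto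
qed

text \<open>The form in which type spaces enter the measure theory: \<open>\<A>\<close> is the algebra of cylinders. By
compactness, a closed subset of an open set \<open>G\<close> lies in a member of \<open>\<A>\<close> contained in \<open>G\<close>, so that values
on \<open>\<A>\<close> control the values of a regular measure on all open sets.\<close>

locale clopen_basis = algebra "topspace X" \<A> for X :: "'b topology" and \<A> +
  assumes compact: "compact_space X"
    and openin_basic: "A \<in> \<A> \<Longrightarrow> openin X A"
    and basic_nhd: "openin X G \<Longrightarrow> p \<in> G \<Longrightarrow> \<exists>A\<in>\<A>. p \<in> A \<and> A \<subseteq> G"
begin

lemma closedin_basic: assumes "A \<in> \<A>" shows "closedin X A"
proof -
  have "openin X (topspace X - A)" using assms by (intro openin_basic) auto
  then show ?thesis using assms sets_into_space by (simp add: closedin_def)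
qed

lemma basic_in_borel_sets [intro]: "A \<in> \<A> \<Longrightarrow> A \<in> sets (borel_sets X)"
  by (auto intro: openin_basic)

lemma finite_basic_subcover:
  assumes C: "closedin X C" and B: "\<And>p. p \<in> C \<Longrightarrow> \<exists>A\<in>\<B>. p \<in> A" and sub: "\<B> \<subseteq> \<A>"
  shows "\<exists>F. finite F \<and> F \<subseteq> \<B> \<and> C \<subseteq> \<Union>F"
proof -
  have "compactin X C" using closedin_compact_space[OF compact C] .
  moreover have "\<forall>G\<in>\<B>. openin X G" "C \<subseteq> \<Union>\<B>" using B sub openin_basic by auto
  ultimately show ?thesis unfolding compactin_def by blast
qed

text \<open>Compactness turns a countable open cover of a basic set into a finite one by basic sets, still
indexed by the original cover. This is what makes the outer content below countably subadditive.\<close>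

lemma basic_split_over_open_union:
  fixes G :: "nat \<Rightarrow> 'b set"
  assumes "A \<in> \<A>" "\<And>n. openin X (G n)" "A \<subseteq> (\<Union>n. G n)"
  shows "\<exists>B N. (\<forall>n. B n \<in> \<A> \<and> B n \<subseteq> G n) \<and> A \<subseteq> (\<Union>n<N. B n)"
proof -
  have "\<exists>B\<in>{B\<in>\<A>. \<exists>n. B \<subseteq> G n}. p \<in> B" if p: "p \<in> A" for p
  proof -
    obtain n where "p \<in> G n" using assms(3) p by blast
    from basic_nhd[OF assms(2) this] obtain B where "B \<in> \<A>" "p \<in> B" "B \<subseteq> G n" by auto
    then show ?thesis by auto
  qed
  from finite_basic_subcover[OF closedin_basic[OF assms(1)] this]
  obtain F where F: "finite F" "F \<subseteq> {B\<in>\<A>. \<exists>n. B \<subseteq> G n}" "A \<subseteq> \<Union>F" by auto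
  have "\<forall>B\<in>F. \<exists>n. B \<subseteq> G n" using F(2) by blast
  then obtain i where i: "\<forall>B\<in>F. B \<subseteq> G (i B)" by (rule bchoice[THEN exE])
  let ?B = "\<lambda>n. \<Union>{B\<in>F. i B = n}"
  have "?B n \<in> \<A>" for n using F by (intro finite_Union) auto
  moreover have "?B n \<subseteq> G n" for n using i by blast
  moreover have "A \<subseteq> (\<Union>n<Suc (Max (i ` F)). ?B n)"
  proof
    fix p assume "p \<in> A"
    then obtain B where B: "B \<in> F" "p \<in> B" using F by blast
    then have "i B < Suc (Max (i ` F))" using F(1) by (simp add: less_Suc_eq_le)
    then show "p \<in> (\<Union>n<Suc (Max (i ` F)). ?B n)" using B by blast
  qed
  ultimately show ?thesis by (intro exI[of _ ?B] exI[of _ "Suc (Max (i ` F))"]) simp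
qed

end

text \<open>A finitely additive probability on the basic sets extends to all Borel sets. Since the basis may be
uncountable, the sigma-algebra generated by it may miss some open sets; therefore open sets
are measured first, from inside, and arbitrary sets from outside by open sets.\<close>

locale content = clopen_basis +
  fixes c :: "'a set \<Rightarrow> real"
  assumes content_nonneg: "A \<in> \<A> \<Longrightarrow> 0 \<le> c A"
    and content_add: "A \<in> \<A> \<Longrightarrow> B \<in> \<A> \<Longrightarrow> A \<inter> B = {} \<Longrightarrow> c (A \<union> B) = c A + c B"
    and content_space: "c (topspace X) = 1"
begin

lemma content_empty: "c {} = 0"
  using content_add[of "{}" "{}"] by auto

lemma content_Un_Diff: "A \<in> \<A> \<Longrightarrow> B \<in> \<A> \<Longrightarrow> A \<subseteq> B \<Longrightarrow> c B = c A + c (B - A)"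
  using content_add[of A "B - A"] by (metis Diff Diff_disjoint Un_Diff_cancel Un_absorb1)

lemma content_mono: "A \<in> \<A> \<Longrightarrow> B \<in> \<A> \<Longrightarrow> A \<subseteq> B \<Longrightarrow> c A \<le> c B"
  using content_Un_Diff[of A B] content_nonneg[of "B - A"] by auto

lemma content_Un_le: assumes "A \<in> \<A>" "B \<in> \<A>" shows "c (A \<union> B) \<le> c A + c B"
proof -
  have "c (A \<union> B) = c (A \<union> (B - A))" by simp
  also have "\<dots> = c A + c (B - A)" using assms by (intro content_add) auto
  also have "c (B - A) \<le> c B" using assms by (intro content_mono) auto
  finally show ?thesis by simp
qed

lemma content_UN_le: "(\<And>n. B n \<in> \<A>) \<Longrightarrow> c (\<Union>n<N::nat. B n) \<le> (\<Sum>n<N. c (B n))"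
proof (induction N)
  case (Suc N)
  have "(\<Union>n<Suc N. B n) = (\<Union>n<N. B n) \<union> B N" by (auto simp: less_Suc_eq)
  moreover have "(\<Union>n<N. B n) \<in> \<A>" using Suc.prems by (intro finite_Union) auto
  ultimately have "c (\<Union>n<Suc N. B n) \<le> c (\<Union>n<N. B n) + c (B N)"
    using Suc.prems content_Un_le[of "\<Union>n<N. B n" "B N"] by auto
  with Suc show ?case by fastforce
qed (simp add: content_empty)

definition open_content :: "'a set \<Rightarrow> ennreal" where
  "open_content G = (SUP A\<in>{A\<in>\<A>. A \<subseteq> G}. ennreal (c A))"

definition outer_content :: "'a set \<Rightarrow> ennreal" where
  "outer_content E = (INF G\<in>{G. openin X G \<and> E \<subseteq> G}. open_content G)"

lemma content_le_open_content: "A \<in> \<A> \<Longrightarrow> A \<subseteq> G \<Longrightarrow> ennreal (c A) \<le> open_content G"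
  unfolding open_content_def by (intro SUP_upper) auto

lemma open_content_mono: "G \<subseteq> H \<Longrightarrow> open_content G \<le> open_content H"
  unfolding open_content_def by (intro SUP_subset_mono) auto

lemma open_content_basic: "A \<in> \<A> \<Longrightarrow> open_content A = ennreal (c A)"
  unfolding open_content_def by (rule antisym) (auto intro!: SUP_least SUP_upper ennreal_leI content_mono)

lemma outer_content_le: "openin X G \<Longrightarrow> E \<subseteq> G \<Longrightarrow> outer_content E \<le> open_content G"
  unfolding outer_content_def by (intro INF_lower) auto

lemma outer_content_open: "openin X G \<Longrightarrow> outer_content G = open_content G"
  by (rule antisym) (auto simp: outer_content_def intro!: INF_greatest INF_lower open_content_mono)

lemma outer_content_mono: "E \<subseteq> E' \<Longrightarrow> outer_content E \<le> outer_content E'"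
  unfolding outer_content_def by (intro INF_superset_mono) auto

lemma outer_content_basic: "A \<in> \<A> \<Longrightarrow> outer_content A = ennreal (c A)"
  by (simp add: outer_content_open openin_basic open_content_basic)

lemma outer_content_near:
  assumes "E \<subseteq> topspace X" "0 < (e::real)"
  obtains G where "openin X G" "E \<subseteq> G" "open_content G \<le> outer_content E + ennreal e"
proof -
  have le1: "outer_content E \<le> ennreal 1"
    using outer_content_mono[OF assms(1)] by (simp add: outer_content_basic content_space)
  have "outer_content E < outer_content E + ennreal e"
  proof (cases "outer_content E")
    case (real r)
    then show ?thesis using assms(2) by (simp add: ennreal_less_iff flip: ennreal_plus)
  qed (use le1 in \<open>auto simp: top_unique\<close>)
  then show ?thesis
    using that unfolding outer_content_def by (auto simp: INF_less_iff intro: less_imp_le)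
qed

lemma open_content_UN_le:
  assumes "\<And>n::nat. openin X (G n)"
  shows "open_content (\<Union>n. G n) \<le> (\<Sum>n. open_content (G n))"
  unfolding open_content_def[of "\<Union>n. G n"]
proof (rule SUP_least)
  fix A assume "A \<in> {A\<in>\<A>. A \<subseteq> (\<Union>n. G n)}"
  then have A: "A \<in> \<A>" "A \<subseteq> (\<Union>n. G n)" by auto
  obtain B N where B: "\<forall>n. B n \<in> \<A> \<and> B n \<subseteq> G n" "A \<subseteq> (\<Union>n<N. B n)"
    using basic_split_over_open_union[OF A(1) assms A(2)] by (elim exE conjE)
  have "c A \<le> c (\<Union>n<N. B n)" using A B by (intro content_mono) auto
  also have "\<dots> \<le> (\<Sum>n<N. c (B n))" using B by (intro content_UN_le) auto
  finally have "ennreal (c A) \<le> (\<Sum>n<N. ennreal (c (B n)))"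
    using B content_nonneg by (subst sum_ennreal) (auto intro: ennreal_leI)
  also have "\<dots> \<le> (\<Sum>n<N. open_content (G n))"
    using B by (intro sum_mono content_le_open_content) auto
  also have "\<dots> \<le> (\<Sum>n. open_content (G n))"
    by (intro sum_le_suminf) auto
  finally show "ennreal (c A) \<le> (\<Sum>n. open_content (G n))" .
qed

lemma outer_content_UN_le:
  assumes E: "\<And>n. E n \<subseteq> topspace X"
  shows "outer_content (\<Union>n. E n) \<le> (\<Sum>n. outer_content (E n))"
proof (rule ennreal_le_epsilon)
  fix e :: real assume e: "0 < e"
  have "\<exists>G. openin X G \<and> E n \<subseteq> G \<and> open_content G \<le> outer_content (E n) + ennreal (e * (1/2)^Suc n)" for n
  proof -
    have "0 < e * (1/2)^Suc n" using e by simp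
    from outer_content_near[OF E this] show ?thesis by blast
  qed
  then obtain G where G: "\<And>n. openin X (G n)" "\<And>n. E n \<subseteq> G n"
     "\<And>n. open_content (G n) \<le> outer_content (E n) + ennreal (e * (1/2)^Suc n)"
    by metis
  have "outer_content (\<Union>n. E n) \<le> open_content (\<Union>n. G n)"
    using G by (intro outer_content_le) auto
  also have "\<dots> \<le> (\<Sum>n. open_content (G n))" by (intro open_content_UN_le G)
  also have "\<dots> \<le> (\<Sum>n. outer_content (E n) + ennreal (e * (1/2)^Suc n))"
    by (intro suminf_le G) auto
  also have "\<dots> = (\<Sum>n. outer_content (E n)) + (\<Sum>n. ennreal (e * (1/2)^Suc n))"
    by (intro suminf_add[symmetric]) auto
  also have "(\<Sum>n. ennreal (e * (1/2)^Suc n)) = ennreal e"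
    using e sums_mult[OF power_half_series, of e]
    by (subst suminf_ennreal2) (auto simp: sums_iff)
  finally show "outer_content (\<Union>n. E n) \<le> (\<Sum>n. outer_content (E n)) + ennreal e" .
qed

lemma outer_measure_space_outer_content: "outer_measure_space (Pow (topspace X)) outer_content"
  unfolding outer_measure_space_def
proof (intro conjI)
  show "positive (Pow (topspace X)) outer_content"
    by (simp add: positive_def outer_content_basic content_empty)
  show "increasing (Pow (topspace X)) outer_content"
    by (simp add: increasing_def outer_content_mono)
  show "countably_subadditive (Pow (topspace X)) outer_content"
    unfolding countably_subadditive_def by (intro allI impI outer_content_UN_le) auto
qed

lemma outer_content_Un_le:
  assumes "E \<subseteq> topspace X" "F \<subseteq> topspace X"
  shows "outer_content (E \<union> F) \<le> outer_content E + outer_content F"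
proof -
  have "outer_content (\<Union>n. binaryset E F n) \<le> (\<Sum>n. outer_content (binaryset E F n))"
    using assms by (intro outer_content_UN_le) (auto simp: binaryset_def)
  then show ?thesis
    using suminf_binaryset_eq[of outer_content E F]
    by (simp add: UN_binaryset_eq outer_content_basic content_empty)
qed

text \<open>Caratheodory's criterion for an open set \<open>G\<close>, tested on an open set \<open>H\<close>: exhaust \<open>G \<inter> H\<close> by basic
\<open>A\<close>, and then exhaust the open set \<open>H - A\<close>, which contains \<open>H - G\<close>.\<close>

lemma open_content_add_outer_content:
  assumes H: "openin X H" and G: "openin X G"
  shows "outer_content (G \<inter> H) + outer_content (H - G) \<le> open_content H"
proof -
  have 1: "ennreal (c A) + outer_content (H - G) \<le> open_content H" if A: "A \<in> \<A>" "A \<subseteq> G \<inter> H" for A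
  proof -
    have op: "openin X (H - A)" using H closedin_basic[OF A(1)] by blast
    have "outer_content (H - G) \<le> open_content (H - A)"
      using A op by (intro outer_content_le) auto
    then have "ennreal (c A) + outer_content (H - G) \<le> ennreal (c A) + open_content (H - A)"
      by (rule add_left_mono)
    also have "\<dots> = (SUP A'\<in>{A'\<in>\<A>. A' \<subseteq> H - A}. ennreal (c A) + ennreal (c A'))"
      unfolding open_content_def by (subst ennreal_SUP_add_right) auto
    also have "\<dots> \<le> open_content H"
    proof (rule SUP_least)
      fix A' assume A': "A' \<in> {A'\<in>\<A>. A' \<subseteq> H - A}"
      have "ennreal (c A) + ennreal (c A') = ennreal (c (A \<union> A'))"
        using A A' content_nonneg by (subst content_add) (auto simp: ennreal_plus)
      also have "\<dots> \<le> open_content H" using A A' by (intro content_le_open_content) auto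
      finally show "ennreal (c A) + ennreal (c A') \<le> open_content H" .
    qed
    finally show ?thesis .
  qed
  have "outer_content (G \<inter> H) + outer_content (H - G) =
      (SUP A\<in>{A\<in>\<A>. A \<subseteq> G \<inter> H}. ennreal (c A) + outer_content (H - G))"
    using G H by (subst outer_content_open) (auto simp: open_content_def intro!: ennreal_SUP_add_left[symmetric])
  also have "\<dots> \<le> open_content H" by (rule SUP_least) (use 1 in auto)
  finally show ?thesis .
qed

text \<open>Testing against open sets is enough, because the outer content of any set is an infimum over open
sets.\<close>

lemma openin_in_lambda_system:
  assumes G: "openin X G"
  shows "G \<in> lambda_system (topspace X) (Pow (topspace X)) outer_content"
  unfolding lambda_system_def
proof (intro CollectI conjI ballI)
  show GX: "G \<in> Pow (topspace X)" using G openin_subset by auto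
  fix E assume E: "E \<in> Pow (topspace X)"
  then have eq: "(topspace X - G) \<inter> E = E - G" by auto
  show "outer_content (G \<inter> E) + outer_content ((topspace X - G) \<inter> E) = outer_content E"
    unfolding eq
  proof (rule antisym)
    have "outer_content ((G \<inter> E) \<union> (E - G)) \<le> outer_content (G \<inter> E) + outer_content (E - G)"
      using E by (intro outer_content_Un_le) auto
    moreover have "(G \<inter> E) \<union> (E - G) = E" by auto
    ultimately show "outer_content E \<le> outer_content (G \<inter> E) + outer_content (E - G)" by simp
    show "outer_content (G \<inter> E) + outer_content (E - G) \<le> outer_content E"
      unfolding outer_content_def[of E]
    proof (rule INF_greatest)
      fix H assume H: "H \<in> {H. openin X H \<and> E \<subseteq> H}"
      have "outer_content (G \<inter> E) + outer_content (E - G) \<le> outer_content (G \<inter> H) + outer_content (H - G)"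
        using H by (intro add_mono outer_content_mono) auto
      also have "\<dots> \<le> open_content H" using H G by (intro open_content_add_outer_content) auto
      finally show "outer_content (G \<inter> E) + outer_content (E - G) \<le> open_content H" .
    qed
  qed
qed

text \<open>Outer regularity is built into the outer content; inner regularity follows by applying it to the
complement.\<close>

lemma regular_borel_extension_exists:
  "\<exists>m. regular_borel_prob X m \<and> (\<forall>A\<in>\<A>. measure m A = c A)"
proof -
  let ?L = "lambda_system (topspace X) (Pow (topspace X)) outer_content"
  define m where "m = measure_of (topspace X) {G. openin X G} outer_content"
  have sub: "{G. openin X G} \<subseteq> Pow (topspace X)" by (auto dest: openin_subset)
  have ms: "measure_space (topspace X) ?L outer_content"
    using sigma_algebra.caratheodory_lemma[OF sigma_algebra_Pow outer_measure_space_outer_content] .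
  then have "sigma_algebra (topspace X) ?L" by (simp add: measure_space_def)
  then have "sigma_sets (topspace X) {G. openin X G} \<subseteq> ?L"
    using openin_in_lambda_system by (intro sigma_algebra.sigma_sets_subset) auto
  then have ms': "measure_space (topspace X) (sigma_sets (topspace X) {G. openin X G}) outer_content"
    using ms sigma_algebra_sigma_sets[OF sub] by (rule_tac measure_down)
  have sets_m: "sets m = sets (borel_sets X)"
    unfolding m_def sets_borel_sets using sub by (simp add: sets_measure_of)
  have em: "emeasure m B = outer_content B" if "B \<in> sets m" for B
    using ms' that sets_m
    by (intro emeasure_measure_of[OF m_def sub]) (simp_all add: sets_borel_sets measure_space_def)
  have space_m: "space m = topspace X" using sets_eq_imp_space_eq[OF sets_m] by simp
  have prob: "prob_space m"
    by (rule prob_spaceI) (simp add: em space_m sets_m openin_in_borel_sets outer_content_basic content_space)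
  then interpret m: prob_space m .
  have outer_reg: "\<exists>G. openin X G \<and> B \<subseteq> G \<and> measure m (G - B) < \<epsilon>"
    if B: "B \<in> sets m" and "0 < \<epsilon>" for B and \<epsilon> :: real
  proof -
    have BX: "B \<subseteq> topspace X" using sets.sets_into_space[OF B] space_m by simp
    obtain G where G: "openin X G" "B \<subseteq> G" "open_content G \<le> outer_content B + ennreal (\<epsilon>/2)"
      using outer_content_near[OF BX, of "\<epsilon>/2"] \<open>0 < \<epsilon>\<close> by auto
    have Gm: "G \<in> sets m" using G sets_m by auto
    have "ennreal (measure m G) \<le> ennreal (measure m B) + ennreal (\<epsilon>/2)"
      using G(3) em[OF Gm] em[OF B] outer_content_open[OF G(1)] by (simp add: m.emeasure_eq_measure)
    then have "measure m G \<le> measure m B + \<epsilon>/2"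
      using \<open>0 < \<epsilon>\<close> by (simp flip: ennreal_plus)
    then have "measure m (G - B) < \<epsilon>"
      using G(2) Gm B \<open>0 < \<epsilon>\<close> by (subst m.finite_measure_Diff) auto
    then show ?thesis using G by blast
  qed
  have "regular_borel_prob X m"
    unfolding regular_borel_prob_def
  proof (intro conjI ballI allI impI sets_m prob)
    fix B and \<epsilon> :: real assume B: "B \<in> sets m" and "0 < \<epsilon>"
    have BX: "B \<subseteq> topspace X" using sets.sets_into_space[OF B] space_m by simp
    obtain G where G: "openin X G" "B \<subseteq> G" "measure m (G - B) < \<epsilon>/2"
      using outer_reg[OF B, of "\<epsilon>/2"] \<open>0 < \<epsilon>\<close> by auto
    have B': "topspace X - B \<in> sets m" using B space_m by (metis sets.compl_sets)
    obtain H where H: "openin X H" "topspace X - B \<subseteq> H" "measure m (H - (topspace X - B)) < \<epsilon>/2"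
      using outer_reg[OF B', of "\<epsilon>/2"] \<open>0 < \<epsilon>\<close> by auto
    have HX: "H \<subseteq> topspace X" "G \<subseteq> topspace X" using H(1) G(1) openin_subset by auto
    have S: "G \<in> sets m" "H \<in> sets m" using G H sets_m by auto
    have "measure m (G - (topspace X - H)) \<le> measure m ((G - B) \<union> (H - (topspace X - B)))"
      using S B B' HX by (intro m.finite_measure_mono) auto
    also have "\<dots> \<le> measure m (G - B) + measure m (H - (topspace X - B))"
      using S B B' by (intro measure_Un_le) auto
    also have "\<dots> < \<epsilon>" using G(3) H(3) by linarith
    finally have "measure m (G - (topspace X - H)) < \<epsilon>" .
    then show "\<exists>C G. closedin X C \<and> openin X G \<and> C \<subseteq> B \<and> B \<subseteq> G \<and> measure m (G - C) < \<epsilon>"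
      using G H BX by (intro exI[of _ "topspace X - H"] exI[of _ G]) auto
  qed
  moreover have "measure m A = c A" if "A \<in> \<A>" for A
    using em[of A] openin_in_borel_sets[OF openin_basic[OF that]] content_nonneg[OF that] that sets_m
    by (simp add: measure_def outer_content_basic)
  ultimately show ?thesis by blast
qed

end

text \<open>Inner regularity gives a closed set in the preimage of \<open>G\<close>; its image is compact and hence covered
by a basic subset of \<open>G\<close>. Thus a regular measure of the preimage of an open set is determined by
the preimages of basic sets, even if there are uncountably many of the latter.\<close>

lemma regular_open_inner_approx:
  assumes X: "clopen_basis X \<A>" and reg: "regular_borel_prob X' m'" and X': "compact_space X'"
    and f: "continuous_map X' X f" and G: "openin X G" and "0 < \<epsilon>"
  obtains A where "A \<in> \<A>" "A \<subseteq> G"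
    "measure m' (f -` G \<inter> topspace X') < measure m' (f -` A \<inter> topspace X') + \<epsilon>"
proof -
  interpret clopen_basis X \<A> by fact
  interpret m': prob_space m' using reg by (simp add: regular_borel_prob_def)
  have sets_m': "sets m' = sets (borel_sets X')" using reg by (simp add: regular_borel_prob_def)
  have pre: "openin X' (f -` H \<inter> topspace X')" if "openin X H" for H
    using openin_continuous_map_preimage[OF f that] by (simp add: vimage_def Int_def conj_commute)
  let ?G = "f -` G \<inter> topspace X'"
  have "?G \<in> sets m'" using pre[OF G] sets_m' by auto
  with reg \<open>0 < \<epsilon>\<close> obtain C H where C: "closedin X' C" "openin X' H" "C \<subseteq> ?G" "?G \<subseteq> H" "measure m' (H - C) < \<epsilon>"
    unfolding regular_borel_prob_def by blast
  have "compactin X (f ` C)"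
    using image_compactin closedin_compact_space[OF X' C(1)] f by blast
  moreover have "\<forall>A\<in>{A\<in>\<A>. A \<subseteq> G}. openin X A" using openin_basic by blast
  moreover have "f ` C \<subseteq> \<Union>{A\<in>\<A>. A \<subseteq> G}" using basic_nhd[OF G] C(3) by blast
  ultimately have "\<exists>F. finite F \<and> F \<subseteq> {A\<in>\<A>. A \<subseteq> G} \<and> f ` C \<subseteq> \<Union>F"
    unfolding compactin_def by blast
  then obtain F where F: "finite F" "F \<subseteq> {A\<in>\<A>. A \<subseteq> G}" "f ` C \<subseteq> \<Union>F" by blast
  have A: "\<Union>F \<in> \<A>" using F by (intro finite_Union) auto
  have S: "C \<in> sets m'" "H \<in> sets m'" "f -` \<Union>F \<inter> topspace X' \<in> sets m'"
  proof -
    have "topspace X' - (topspace X' - C) = C" using closedin_subset[OF C(1)] by auto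
    moreover have "topspace X' - C \<in> sets m'" using C(1) sets_m' by (auto simp: closedin_def)
    ultimately show "C \<in> sets m'" by (metis sets.compl_sets sets_eq_imp_space_eq sets_m' space_borel_sets)
    show "H \<in> sets m'" using C sets_m' by auto
    show "f -` \<Union>F \<inter> topspace X' \<in> sets m'" using pre[OF openin_basic[OF A]] sets_m' by auto
  qed
  have "measure m' ?G \<le> measure m' H" using C S by (intro m'.finite_measure_mono) auto
  also have "\<dots> = measure m' C + measure m' (H - C)"
    using C S by (subst m'.finite_measure_Diff) auto
  also have "\<dots> < measure m' C + \<epsilon>" using C by simp
  also have "measure m' C \<le> measure m' (f -` \<Union>F \<inter> topspace X')"
  proof (rule m'.finite_measure_mono)
    show "C \<subseteq> f -` \<Union>F \<inter> topspace X'" using F(3) C(3) by blast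
  qed (rule S)
  finally show ?thesis using F A by (intro that[of "\<Union>F"]) auto
qed

text \<open>By inner approximation, agreement on basic sets extends to open sets, which generate the Borel sets
and are closed under intersection. With the identity map this is uniqueness of the regular
extension, and with restriction maps between type spaces it is the independence of the Morley product from the model.\<close>

lemma distr_regular_borel_prob_eq:
  assumes X: "clopen_basis X \<A>" and reg: "regular_borel_prob X m"
    and reg': "regular_borel_prob X' m'" and X': "compact_space X'" and f: "continuous_map X' X f"
    and eq: "\<And>A. A \<in> \<A> \<Longrightarrow> measure m' (f -` A \<inter> topspace X') = measure m A"
  shows "distr m' (borel_sets X) f = m"
proof -
  interpret clopen_basis X \<A> by fact
  interpret m: prob_space m using reg by (simp add: regular_borel_prob_def)
  interpret m': prob_space m' using reg' by (simp add: regular_borel_prob_def)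
  have sets_m': "sets m' = sets (borel_sets X')" using reg' by (simp add: regular_borel_prob_def)
  have sets_m: "sets m = sets (borel_sets X)" using reg by (simp add: regular_borel_prob_def)
  have sp: "space m' = topspace X'" "space m = topspace X"
    using sets_eq_imp_space_eq[OF sets_m'] sets_eq_imp_space_eq[OF sets_m] by auto
  have f_meas: "f \<in> measurable m' (borel_sets X)"
    using continuous_map_measurable_borel_sets[OF f] measurable_cong_sets[OF sets_m' refl] by auto
  have open_eq: "measure m' (f -` G \<inter> topspace X') = measure m G" if G: "openin X G" for G
  proof (rule antisym)
    have fG: "f -` G \<inter> topspace X' \<in> sets m'"
      using measurable_sets[OF f_meas, of G] G sp by auto
    have GX: "G \<inter> topspace X = G" using openin_subset[OF G] by auto
    show "measure m' (f -` G \<inter> topspace X') \<le> measure m G"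
    proof (rule field_le_epsilon)
      fix e :: real assume "0 < e"
      then obtain A where A: "A \<in> \<A>" "A \<subseteq> G"
        "measure m' (f -` G \<inter> topspace X') < measure m' (f -` A \<inter> topspace X') + e"
        using regular_open_inner_approx[OF X reg' X' f G] by metis
      moreover have "measure m A \<le> measure m G"
        using A G sets_m by (intro m.finite_measure_mono) auto
      ultimately show "measure m' (f -` G \<inter> topspace X') \<le> measure m G + e" using eq by fastforce
    qed
    show "measure m G \<le> measure m' (f -` G \<inter> topspace X')"
    proof (rule field_le_epsilon)
      fix e :: real assume "0 < e"
      then obtain A where A: "A \<in> \<A>" "A \<subseteq> G"
        "measure m (id -` G \<inter> topspace X) < measure m (id -` A \<inter> topspace X) + e"
        using regular_open_inner_approx[OF X reg compact continuous_map_id G] by metis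
      moreover have "A \<inter> topspace X = A" using A(1) sets_into_space by auto
      moreover have "measure m' (f -` A \<inter> topspace X') \<le> measure m' (f -` G \<inter> topspace X')"
        using A(2) fG by (intro m'.finite_measure_mono) auto
      ultimately show "measure m G \<le> measure m' (f -` G \<inter> topspace X') + e"
        using eq[OF A(1)] GX by simp
    qed
  qed
  show ?thesis
  proof (rule measure_eqI_generator_eq[where E = "{G. openin X G}" and \<Omega> = "topspace X" and A = "\<lambda>_::nat. topspace X"])
    show "Int_stable {G. openin X G}" by (auto simp: Int_stable_def)
    show "{G. openin X G} \<subseteq> Pow (topspace X)" by (auto dest: openin_subset)
    show "emeasure (distr m' (borel_sets X) f) G = emeasure m G" if "G \<in> {G. openin X G}" for G
      using that open_eq[of G] f_meas
      by (subst emeasure_distr) (auto simp: sp m.emeasure_eq_measure m'.emeasure_eq_measure)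
    show "emeasure (distr m' (borel_sets X) f) (topspace X) \<noteq> \<infinity>"
      using f_meas by (subst emeasure_distr) (auto simp: m'.emeasure_eq_measure)
  qed (auto simp: sets_m sets_borel_sets)
qed

inductive step_fun :: "'b set set \<Rightarrow> ('b \<Rightarrow> real) \<Rightarrow> bool" for \<A> where
  zero: "step_fun \<A> (\<lambda>_. 0)"
| add: "step_fun \<A> h \<Longrightarrow> A \<in> \<A> \<Longrightarrow> step_fun \<A> (\<lambda>p. h p + r * indicator A p)"

text \<open>Every point has a basic neighbourhood on which \<open>f\<close> is nearly constant. Finitely many of them cover
the space, and they are made disjoint one at a time.\<close>

lemma (in clopen_basis) continuous_step_approx:
  assumes f: "continuous_map X euclideanreal f" and "0 < \<epsilon>"
  obtains h where "step_fun \<A> h" "\<And>p. p \<in> topspace X \<Longrightarrow> \<bar>f p - h p\<bar> < \<epsilon>"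
proof -
  let ?B = "{A\<in>\<A>. \<exists>r. \<forall>p\<in>A. \<bar>f p - r\<bar> < \<epsilon>}"
  have "\<exists>A\<in>?B. p \<in> A" if p: "p \<in> topspace X" for p
  proof -
    let ?G = "{q\<in>topspace X. f q \<in> ball (f p) \<epsilon>}"
    have "openin X ?G" using f by (rule openin_continuous_map_preimage) simp
    moreover have "p \<in> ?G" using p \<open>0 < \<epsilon>\<close> by simp
    ultimately obtain A where A: "A \<in> \<A>" "p \<in> A" "A \<subseteq> ?G" using basic_nhd[of ?G p] by blast
    then have "\<forall>q\<in>A. \<bar>f q - f p\<bar> < \<epsilon>" by (auto simp: dist_real_def abs_minus_commute)
    then show ?thesis using A by blast
  qed
  from finite_basic_subcover[OF closedin_topspace this]
  obtain F where F: "finite F" "F \<subseteq> ?B" "topspace X \<subseteq> \<Union>F" by auto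
  have "\<exists>h. step_fun \<A> h \<and> (\<forall>p\<in>\<Union>F. \<bar>f p - h p\<bar> < \<epsilon>) \<and> (\<forall>p. p \<notin> \<Union>F \<longrightarrow> h p = 0)"
    using F(1,2)
  proof (induction F)
    case empty
    then show ?case using step_fun.zero[of \<A>] by (intro exI[of _ "\<lambda>_. 0"]) auto
  next
    case (insert A F)
    then obtain h where h: "step_fun \<A> h" "\<forall>p\<in>\<Union>F. \<bar>f p - h p\<bar> < \<epsilon>" "\<forall>p. p \<notin> \<Union>F \<longrightarrow> h p = 0"
      by blast
    obtain r where r: "A \<in> \<A>" "\<And>p. p \<in> A \<Longrightarrow> \<bar>f p - r\<bar> < \<epsilon>" using insert.prems by auto
    have D: "A - \<Union>F \<in> \<A>" using r insert by (intro Diff finite_Union) auto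
    show ?case
      using step_fun.add[OF h(1) D, of r] h(2,3) r(2)
      by (intro exI[of _ "\<lambda>p. h p + r * indicator (A - \<Union>F) p"]) (auto simp: indicator_def)
  qed
  then show ?thesis using that F(3) by blast
qed

section \<open>Substitution\<close>

text \<open>The variable assignment at which a formula has to be evaluated after the tuple \<open>b\<close> has been
substituted for \<open>x\<close>.\<close>

definition assign_tuple :: "nat list \<Rightarrow> 'a list \<Rightarrow> (nat \<Rightarrow> 'a) \<Rightarrow> nat \<Rightarrow> 'a" where
  "assign_tuple x b e v = (case map_of (zip x b) v of None \<Rightarrow> e v | Some a \<Rightarrow> a)"

lemma eval_subst_tm:
  "eval_tm U e (subst_tm s t) = eval_tm U (\<lambda>v. case s v of None \<Rightarrow> e v | Some a \<Rightarrow> a) t"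
  by (induction t) (auto split: option.splits simp: comp_def cong: map_cong)

lemma sat_in_subst:
  "sat_in U M e (subst \<phi> s) \<longleftrightarrow> sat_in U M (\<lambda>v. case s v of None \<Rightarrow> e v | Some a \<Rightarrow> a) \<phi>"
proof (induction \<phi> arbitrary: s e)
  case (Ex w \<phi>)
  have "(\<lambda>v. case (s(w := None)) v of None \<Rightarrow> (e(w := a)) v | Some b \<Rightarrow> b) =
     (\<lambda>v. case s v of None \<Rightarrow> e v | Some b \<Rightarrow> b)(w := a)" for a
    by (simp add: fun_eq_iff split: option.split)
  then show ?case by (simp add: Ex.IH)
qed (auto simp: eval_subst_tm comp_def cong: map_cong)

lemma sat_inst: "sat_in U M e (inst x b \<phi>) \<longleftrightarrow> sat_in U M (assign_tuple x b e) \<phi>"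
  unfolding inst_def sat_in_subst assign_tuple_def ..

lemma eval_tm_cong: "(\<And>v. v \<in> tm_fv t \<Longrightarrow> e v = e' v) \<Longrightarrow> eval_tm U e t = eval_tm U e' t"
proof (induction t)
  case (Fn f ts)
  have "eval_tm U e t = eval_tm U e' t" if t: "t \<in> set ts" for t
    using Fn.prems t by (intro Fn.IH) auto
  then show ?case by (simp cong: map_cong)
qed auto

lemma sat_in_cong: "(\<And>v. v \<in> fv \<phi> \<Longrightarrow> e v = e' v) \<Longrightarrow> sat_in U M e \<phi> \<longleftrightarrow> sat_in U M e' \<phi>"
proof (induction \<phi> arbitrary: e e')
  case (Eq s t)
  then have "eval_tm U e s = eval_tm U e' s" "eval_tm U e t = eval_tm U e' t"
    by (auto intro!: eval_tm_cong)
  then show ?case by simp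
next
  case (Rel r ts)
  then have "map (eval_tm U e) ts = map (eval_tm U e') ts"
    by (auto intro!: eval_tm_cong)
  then show ?case by (simp del: map_eq_conv)
next
  case (Neg \<phi>)
  then show ?case by (metis fv.simps(3) sat_in.simps(3))
next
  case (Conj \<phi> \<psi>)
  have "sat_in U M e \<phi> \<longleftrightarrow> sat_in U M e' \<phi>" using Conj.prems by (intro Conj.IH(1)) auto
  moreover have "sat_in U M e \<psi> \<longleftrightarrow> sat_in U M e' \<psi>" using Conj.prems by (intro Conj.IH(2)) auto
  ultimately show ?case by simp
next
  case (Ex w \<phi>)
  have "sat_in U M (e(w := a)) \<phi> \<longleftrightarrow> sat_in U M (e'(w := a)) \<phi>" for a
    using Ex.prems by (intro Ex.IH) auto
  then show ?case by simp
qed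

lemma tm_fv_subst: "tm_fv (subst_tm s t) = tm_fv t - dom s"
  by (induction t) (auto split: option.splits)

lemma fv_subst: "fv (subst \<phi> s) = fv \<phi> - dom s"
  by (induction \<phi> arbitrary: s) (auto simp: tm_fv_subst)

lemma wf_subst_tm [simp]: "wf_tm L (subst_tm s t) = wf_tm L t"
  by (induction t) (auto split: option.splits simp: list_all_iff)

lemma wf_subst [simp]: "wf_fm L (subst \<phi> s) = wf_fm L \<phi>"
  by (induction \<phi> arbitrary: s) (auto simp: list_all_iff)

lemma params_subst_tm: "tm_params (subst_tm s t) \<subseteq> tm_params t \<union> ran s"
  by (induction t) (auto split: option.splits simp: ran_def)

lemma params_subst: "params (subst \<phi> s) \<subseteq> params \<phi> \<union> ran s"
proof (induction \<phi> arbitrary: s)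
  case (Eq t u)
  then show ?case using params_subst_tm[of s t] params_subst_tm[of s u] by auto
next
  case (Rel r ts)
  then show ?case using params_subst_tm[of s] by fastforce
next
  case (Ex w \<phi>)
  have "ran (s(w := None)) \<subseteq> ran s" by (auto simp: ran_def)
  then show ?case using Ex[of "s(w := None)"] by (simp del: fun_upd_apply) blast
qed auto

lemma subst_tm_subst_tm: "subst_tm t (subst_tm s u) = subst_tm (t ++ s) u"
  by (induction u) (auto split: option.splits simp: map_add_def)

lemma subst_subst: "subst (subst \<phi> s) t = subst \<phi> (t ++ s)"
proof (induction \<phi> arbitrary: s t)
  case (Ex w \<phi>)
  have "t(w := None) ++ s(w := None) = (t ++ s)(w := None)" by (simp add: map_add_def fun_eq_iff split: option.split)
  then show ?case by (simp add: Ex.IH del: fun_upd_apply)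
qed (auto simp: subst_tm_subst_tm)

lemma subst_tm_empty [simp]: "subst_tm Map.empty t = t"
  by (induction t) (auto simp: map_idI)

lemma subst_empty [simp]: "subst \<phi> Map.empty = \<phi>"
  by (induction \<phi>) (auto simp: map_idI)

lemma inst_Nil [simp]: "inst [] [] \<phi> = \<phi>"
  by (simp add: inst_def)

lemma inst_Neg [simp]: "inst x b (Neg \<phi>) = Neg (inst x b \<phi>)"
  by (simp add: inst_def)

lemma inst_commute:
  assumes "length a = length x" "length b = length y" "set x \<inter> set y = {}"
  shows "inst x a (inst y b \<phi>) = inst y b (inst x a \<phi>)"
  using assms unfolding inst_def subst_subst by (subst map_add_comm) auto

lemma inst_append:
  assumes "length b = length y" "length c = length z" "set y \<inter> set z = {}"
  shows "inst (y @ z) (b @ c) \<phi> = inst y b (inst z c \<phi>)"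
  using assms unfolding inst_def subst_subst by (simp, subst map_add_comm) auto

lemma inst_in_forms:
  assumes "\<phi> \<in> forms L x A" "c \<in> tuples z B" "set x - set z \<subseteq> set y" "A \<union> B \<subseteq> N"
  shows "inst z c \<phi> \<in> forms L y N"
proof -
  have ran: "ran (map_of (zip z c)) \<subseteq> B"
    using assms(2) by (auto simp: tuples_def ran_def dest!: map_of_SomeD set_zip_rightD)
  have "dom (map_of (zip z c)) = set z" using assms(2) by (simp add: tuples_def)
  then have "fv (inst z c \<phi>) \<subseteq> set y"
    using assms by (auto simp: forms_def inst_def fv_subst)
  moreover have "params (inst z c \<phi>) \<subseteq> N"
    using params_subst[of \<phi> "map_of (zip z c)"] ran assms(1,4) unfolding inst_def forms_def by blast
  ultimately show ?thesis using assms(1) by (simp add: forms_def inst_def)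
qed

lemma assign_tuple_inside: "length b = length x \<Longrightarrow> v \<in> set x \<Longrightarrow> assign_tuple x b e v = assign_tuple x b e' v"
  by (metis assign_tuple_def dom_map_of_zip domIff option.case_eq_if)

lemma assign_tuple_map [simp]: "assign_tuple x (map e x) e = e"
  by (auto simp: assign_tuple_def map_of_zip_map)

lemma holds_inst_iff:
  assumes "length b = length x" "fv \<phi> \<subseteq> set x"
  shows "holds U (inst x b \<phi>) \<longleftrightarrow> sat U (assign_tuple x b e) \<phi>"
proof -
  have "sat U (assign_tuple x b e) \<phi> \<longleftrightarrow> sat U (assign_tuple x b e') \<phi>" for e'
    using assms assign_tuple_inside by (intro sat_in_cong) blast
  then show ?thesis by (simp add: holds_def sat_inst) blast
qed

lemma holds_inst_map: "fv \<phi> \<subseteq> set x \<Longrightarrow> holds U (inst x (map e x) \<phi>) \<longleftrightarrow> sat U e \<phi>"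
  using holds_inst_iff[of "map e x" x \<phi> U e] by simp

lemma holds_inst_Neg:
  assumes "length b = length x" "fv \<phi> \<subseteq> set x"
  shows "holds U (inst x b (Neg \<phi>)) \<longleftrightarrow> \<not> holds U (inst x b \<phi>)"
  using holds_inst_iff[OF assms, of U] holds_inst_iff[of b x "Neg \<phi>" U] assms by simp

section \<open>Replacing parameters by variables\<close>

text \<open>Invariance and definability are stated for formulas without parameters only. A formula with
parameters is an instance of such a formula, with fresh variables in place of the parameters; the
variables must also avoid the bound variables, so that substituting back is literally the inverse.\<close>

primrec tm_par_to_var :: "('a \<Rightarrow> nat) \<Rightarrow> ('f, 'a) tm \<Rightarrow> ('f, 'a) tm" where
  "tm_par_to_var g (Var v) = Var v"
| "tm_par_to_var g (Par a) = Var (g a)"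
| "tm_par_to_var g (Fn f ts) = Fn f (map (tm_par_to_var g) ts)"

primrec fm_par_to_var :: "('a \<Rightarrow> nat) \<Rightarrow> ('f, 'r, 'a) fm \<Rightarrow> ('f, 'r, 'a) fm" where
  "fm_par_to_var g (Eq s t) = Eq (tm_par_to_var g s) (tm_par_to_var g t)"
| "fm_par_to_var g (Rel r ts) = Rel r (map (tm_par_to_var g) ts)"
| "fm_par_to_var g (Neg \<phi>) = Neg (fm_par_to_var g \<phi>)"
| "fm_par_to_var g (Conj \<phi> \<psi>) = Conj (fm_par_to_var g \<phi>) (fm_par_to_var g \<psi>)"
| "fm_par_to_var g (Ex v \<phi>) = Ex v (fm_par_to_var g \<phi>)"

primrec all_vars :: "('f, 'r, 'a) fm \<Rightarrow> nat set" where
  "all_vars (Eq s t) = tm_fv s \<union> tm_fv t"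
| "all_vars (Rel r ts) = \<Union> (tm_fv ` set ts)"
| "all_vars (Neg \<phi>) = all_vars \<phi>"
| "all_vars (Conj \<phi> \<psi>) = all_vars \<phi> \<union> all_vars \<psi>"
| "all_vars (Ex v \<phi>) = insert v (all_vars \<phi>)"

lemma finite_tm_fv [simp]: "finite (tm_fv t)" by (induction t) auto

lemma finite_all_vars [simp]: "finite (all_vars \<phi>)" by (induction \<phi>) auto

lemma finite_tm_params [simp]: "finite (tm_params t)" by (induction t) auto

lemma finite_params [simp]: "finite (params \<phi>)" by (induction \<phi>) auto

lemma subst_tm_par_to_var:
  "(\<And>a. a \<in> tm_params t \<Longrightarrow> s (g a) = Some a) \<Longrightarrow> (\<And>v. v \<in> tm_fv t \<Longrightarrow> s v = None) \<Longrightarrow>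
   subst_tm s (tm_par_to_var g t) = t"
proof (induction t)
  case (Fn f ts)
  have "subst_tm s (tm_par_to_var g t) = t" if t: "t \<in> set ts" for t
    using Fn.prems t by (intro Fn.IH) (metis UN_I tm.set(3), auto)
  then show ?case by (auto intro!: map_idI)
qed auto

lemma subst_fm_par_to_var:
  "(\<And>a. a \<in> params \<phi> \<Longrightarrow> s (g a) = Some a) \<Longrightarrow> (\<And>v. v \<in> all_vars \<phi> \<Longrightarrow> s v = None) \<Longrightarrow>
   subst (fm_par_to_var g \<phi>) s = \<phi>"
proof (induction \<phi>)
  case (Rel f ts)
  have "subst_tm s (tm_par_to_var g t) = t" if t: "t \<in> set ts" for t
    using Rel.prems t by (intro subst_tm_par_to_var) (metis UN_I fm.set(2), auto)
  then show ?case by (auto intro!: map_idI)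
next
  case (Ex w \<phi>)
  then have "s(w := None) = s" by auto
  with Ex show ?case by simp
qed (auto intro!: map_idI subst_tm_par_to_var)

lemma tm_fv_par_to_var: "tm_fv (tm_par_to_var g t) = tm_fv t \<union> g ` tm_params t"
  by (induction t) auto

lemma fv_fm_par_to_var: "fv (fm_par_to_var g \<phi>) \<subseteq> fv \<phi> \<union> g ` params \<phi>"
  by (induction \<phi>) (auto simp: tm_fv_par_to_var)

lemma tm_params_par_to_var [simp]: "tm_params (tm_par_to_var g t) = {}"
  by (induction t) auto

lemma params_fm_par_to_var [simp]: "params (fm_par_to_var g \<phi>) = {}"
  by (induction \<phi>) auto

lemma wf_tm_par_to_var [simp]: "wf_tm L (tm_par_to_var g t) = wf_tm L t"
  by (induction t) (auto simp: list_all_iff)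

lemma wf_fm_par_to_var [simp]: "wf_fm L (fm_par_to_var g \<phi>) = wf_fm L \<phi>"
  by (induction \<phi>) (auto simp: list_all_iff)

lemma parameters_as_instance:
  fixes \<phi> :: "('f, 'r, 'a) fm"
  assumes "\<phi> \<in> forms L x N"
  obtains z c \<phi>\<^sub>0 where "distinct z" "set z \<inter> set x = {}" "c \<in> tuples z N"
    "\<phi>\<^sub>0 \<in> forms L (x @ z) {}" "\<phi> = inst z c \<phi>\<^sub>0"
proof -
  obtain f :: "'a \<Rightarrow> nat" where f: "inj_on f (params \<phi>)"
    using finite_imp_inj_to_nat_seg[OF finite_params[of \<phi>]] by blast
  define V where "V = set x \<union> all_vars \<phi>"
  have "finite V" by (simp add: V_def)
  then have "\<exists>n. \<forall>v\<in>V. v < n" by (simp add: finite_nat_set_iff_bounded)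
  then obtain n where n: "\<forall>v\<in>V. v < n" ..
  \<comment> \<open>The variable replacing the parameter \<open>a\<close>; all of these lie beyond the variables in \<open>V\<close>.\<close>
  define g where "g = (\<lambda>a. n + f a)"
  obtain c where c: "set c = params \<phi>" "distinct c" using finite_distinct_list[OF finite_params[of \<phi>]] by blast
  have g: "inj_on g (set c)" using f c(1) by (auto simp: inj_on_def g_def)
  have gV: "g a \<notin> V" for a using n by (auto simp: g_def)
  have look: "map_of (zip (map g c) c) (g a) = Some a" if "a \<in> set c" for a
  proof -
    have "(g a, a) \<in> set (zip (map g c) c)" using that by (induction c) auto
    then show ?thesis using g c by (intro map_of_is_SomeI) (auto simp: distinct_map)
  qed
  have "map_of (zip (map g c) c) v = None" if "v \<in> V" for v
    using gV that map_of_zip_is_None[of "map g c" c v] by (auto simp del: map_of_zip_is_None)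
  then have "inst (map g c) c (fm_par_to_var g \<phi>) = \<phi>"
    unfolding inst_def by (intro subst_fm_par_to_var) (auto simp: look c V_def)
  moreover have "fm_par_to_var g \<phi> \<in> forms L (x @ map g c) {}"
    using assms fv_fm_par_to_var[of g \<phi>] c by (auto simp: forms_def)
  moreover have "set (map g c) \<inter> set x = {}" using gV by (auto simp: V_def)
  ultimately show ?thesis
    using c g assms by (intro that[of "map g c" c "fm_par_to_var g \<phi>"]) (auto simp: distinct_map forms_def tuples_def)
qed

section \<open>Types\<close>

lemma Neg_in_forms [simp]: "Neg \<phi> \<in> forms L x A \<longleftrightarrow> \<phi> \<in> forms L x A"
  and Conj_in_forms [simp]: "Conj \<phi> \<psi> \<in> forms L x A \<longleftrightarrow> \<phi> \<in> forms L x A \<and> \<psi> \<in> forms L x A"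
  by (auto simp: forms_def)

lemma forms_fv: "\<phi> \<in> forms L x A \<Longrightarrow> fv \<phi> \<subseteq> set x"
  by (simp add: forms_def)

lemma forms_mono: "\<phi> \<in> forms L x A \<Longrightarrow> set x \<subseteq> set y \<Longrightarrow> A \<subseteq> B \<Longrightarrow> \<phi> \<in> forms L y B"
  by (auto simp: forms_def)

lemma forms_UNIV: "\<phi> \<in> forms L x A \<Longrightarrow> \<phi> \<in> forms L x UNIV"
  by (auto simp: forms_def)

text \<open>The quantifier makes this a sentence without symbols or parameters, hence a member of every set of
formulas, also over the empty tuple of variables.\<close>

definition tautology :: "('f, 'r, 'a) fm" where
  "tautology = Ex 0 (Eq (Var 0) (Var 0))"

lemma tautology_in_forms [simp]: "tautology \<in> forms L x A"
  by (auto simp: tautology_def forms_def)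

lemma sat_tautology [simp]: "sat U e tautology"
  by (simp add: tautology_def)

lemma types_sat: "p \<in> types U x A \<Longrightarrow> finite P \<Longrightarrow> P \<subseteq> p \<Longrightarrow> \<exists>e. \<forall>\<phi>\<in>P. sat U e \<phi>"
  by (simp add: types_def)

lemma types_forms: "p \<in> types U x A \<Longrightarrow> \<phi> \<in> p \<Longrightarrow> \<phi> \<in> forms U x A"
  by (auto simp: types_def)

lemma types_Neg_iff:
  assumes "p \<in> types U x A" "\<phi> \<in> forms U x A"
  shows "Neg \<phi> \<in> p \<longleftrightarrow> \<phi> \<notin> p"
  using types_sat[OF assms(1), of "{\<phi>, Neg \<phi>}"] assms by (auto simp: types_def)

lemma types_entails:
  assumes p: "p \<in> types U x A" and P: "finite P" "P \<subseteq> p" and \<phi>: "\<phi> \<in> forms U x A"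
    and ent: "\<And>e. (\<forall>\<psi>\<in>P. sat U e \<psi>) \<Longrightarrow> sat U e \<phi>"
  shows "\<phi> \<in> p"
proof (rule ccontr)
  assume "\<phi> \<notin> p"
  then have "insert (Neg \<phi>) P \<subseteq> p" using types_Neg_iff[OF p \<phi>] P by auto
  then obtain e where "\<forall>\<psi>\<in>insert (Neg \<phi>) P. sat U e \<psi>" using types_sat[OF p] P by blast
  then show False using ent[of e] by auto
qed

lemma types_Conj_iff:
  assumes p: "p \<in> types U x A" and "\<phi> \<in> forms U x A" "\<psi> \<in> forms U x A"
  shows "Conj \<phi> \<psi> \<in> p \<longleftrightarrow> \<phi> \<in> p \<and> \<psi> \<in> p"
proof
  assume "Conj \<phi> \<psi> \<in> p"
  then show "\<phi> \<in> p \<and> \<psi> \<in> p"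
    using types_entails[OF p, of "{Conj \<phi> \<psi>}"] assms by auto
next
  assume "\<phi> \<in> p \<and> \<psi> \<in> p"
  then show "Conj \<phi> \<psi> \<in> p"
    using types_entails[OF p, of "{\<phi>, \<psi>}" "Conj \<phi> \<psi>"] assms by auto
qed

lemma types_eqI:
  assumes "p \<in> types U x A" "q \<in> types U x A" "p \<subseteq> q"
  shows "p = q"
proof (rule subset_antisym[OF assms(3)], rule subsetI)
  fix \<phi> assume \<phi>: "\<phi> \<in> q"
  then have form: "\<phi> \<in> forms U x A" using types_forms[OF assms(2)] by blast
  then have "Neg \<phi> \<notin> p" using types_Neg_iff[OF assms(2)] \<phi> assms(3) by blast
  then show "\<phi> \<in> p" using types_Neg_iff[OF assms(1) form] by blast
qed

lemma tp_in_types: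
  assumes "length b = length x"
  shows "tp U x A b \<in> types U x A"
  unfolding types_def
proof (intro CollectI conjI allI impI ballI)
  show "tp U x A b \<subseteq> forms U x A" by (auto simp: tp_def)
  show "\<exists>e. \<forall>\<phi>\<in>P. sat U e \<phi>" if "finite P \<and> P \<subseteq> tp U x A b" for P
    using that holds_inst_iff[OF assms, of _ U undefined]
    by (intro exI[of _ "assign_tuple x b undefined"]) (auto simp: tp_def forms_fv)
  show "\<phi> \<in> tp U x A b \<or> Neg \<phi> \<in> tp U x A b" if "\<phi> \<in> forms U x A" for \<phi>
    using that holds_inst_Neg[OF assms forms_fv[OF that], of U] by (auto simp: tp_def)
qed

lemma realizes_tp_eq:
  assumes "p \<in> types U x A" "realizes U x b p"
  shows "tp U x A b = p"
proof (rule types_eqI[symmetric, OF assms(1)])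
  show "tp U x A b \<in> types U x A"
    using assms(2) by (intro tp_in_types) (simp add: realizes_def tuples_def)
  show "p \<subseteq> tp U x A b"
    using assms(2) types_forms[OF assms(1)] by (auto simp: realizes_def tp_def)
qed

lemma realizes_tp: "length b = length x \<Longrightarrow> realizes U x b (tp U x A b)"
  by (simp add: realizes_def tuples_def tp_def)

lemma in_tp_iff: "\<phi> \<in> forms U x A \<Longrightarrow> \<phi> \<in> tp U x A b \<longleftrightarrow> holds U (inst x b \<phi>)"
  by (simp add: tp_def)

definition fin_sat :: "('f, 'r, 'a) struct \<Rightarrow> ('f, 'r, 'a) fm set \<Rightarrow> bool" where
  "fin_sat U \<Gamma> \<longleftrightarrow> (\<forall>P. finite P \<and> P \<subseteq> \<Gamma> \<longrightarrow> (\<exists>e. \<forall>\<phi>\<in>P. sat U e \<phi>))"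

text \<open>Lindenbaum's lemma. A finitely satisfiable set that is maximal (by Zorn) decides every formula:
otherwise finite subsets refuting \<open>\<phi>\<close> and its negation would together be unsatisfiable.\<close>

lemma fin_sat_extends_to_type:
  assumes "\<Gamma> \<subseteq> forms U x A" "fin_sat U \<Gamma>"
  shows "\<exists>p\<in>types U x A. \<Gamma> \<subseteq> p"
proof -
  let ?\<A> = "{p. \<Gamma> \<subseteq> p \<and> p \<subseteq> forms U x A \<and> fin_sat U p}"
  have "\<exists>p\<in>?\<A>. \<forall>q\<in>?\<A>. p \<subseteq> q \<longrightarrow> q = p"
  proof (rule subset_Zorn_nonempty)
    show "?\<A> \<noteq> {}" using assms by blast
    fix C assume C: "C \<noteq> {}" "subset.chain ?\<A> C"
    then have sub: "C \<subseteq> ?\<A>" by (simp add: subset_chain_def)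
    have "fin_sat U (\<Union>C)"
      unfolding fin_sat_def
    proof (intro allI impI)
      fix P assume "finite P \<and> P \<subseteq> \<Union>C"
      then obtain p where "p \<in> C" "P \<subseteq> p" "finite P"
        using finite_subset_Union_chain[of P C ?\<A>] C by blast
      then show "\<exists>e. \<forall>\<phi>\<in>P. sat U e \<phi>" using sub by (auto simp: fin_sat_def)
    qed
    then show "\<Union>C \<in> ?\<A>" using sub C(1) by blast
  qed
  then obtain p where pA: "p \<in> ?\<A>" and max: "\<forall>q\<in>?\<A>. p \<subseteq> q \<longrightarrow> q = p" by (rule bexE)
  from pA have p: "\<Gamma> \<subseteq> p" "p \<subseteq> forms U x A" "fin_sat U p" by auto
  have wit: "\<exists>P. finite P \<and> P \<subseteq> p \<and> (\<forall>e. (\<forall>\<psi>\<in>P. sat U e \<psi>) \<longrightarrow> \<not> sat U e \<phi>)"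
    if \<phi>: "\<phi> \<in> forms U x A" "\<phi> \<notin> p" for \<phi>
  proof -
    have "\<not> fin_sat U (insert \<phi> p)" using bspec[OF max, of "insert \<phi> p"] \<phi> p by auto
    then obtain P where P: "finite P" "P \<subseteq> insert \<phi> p" "\<not> (\<exists>e. \<forall>\<psi>\<in>P. sat U e \<psi>)"
      unfolding fin_sat_def by blast
    then show ?thesis by (intro exI[of _ "P - {\<phi>}"]) auto
  qed
  have "\<phi> \<in> p \<or> Neg \<phi> \<in> p" if \<phi>: "\<phi> \<in> forms U x A" for \<phi>
  proof (rule ccontr)
    assume neither: "\<not> (\<phi> \<in> p \<or> Neg \<phi> \<in> p)"
    obtain P where P: "finite P" "P \<subseteq> p" "\<And>e. (\<forall>\<psi>\<in>P. sat U e \<psi>) \<Longrightarrow> \<not> sat U e \<phi>"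
      using wit[of \<phi>] neither \<phi> by blast
    obtain Q where Q: "finite Q" "Q \<subseteq> p" "\<And>e. (\<forall>\<psi>\<in>Q. sat U e \<psi>) \<Longrightarrow> \<not> sat U e (Neg \<phi>)"
      using wit[of "Neg \<phi>"] neither \<phi> by auto
    have "finite (P \<union> Q)" "P \<union> Q \<subseteq> p" using P Q by auto
    then obtain e where "\<forall>\<psi>\<in>P \<union> Q. sat U e \<psi>" using p(3) unfolding fin_sat_def by blast
    then show False using P(3)[of e] Q(3)[of e] by auto
  qed
  then have "p \<in> types U x A" using p by (auto simp: types_def fin_sat_def)
  then show ?thesis using p(1) by blast
qed

section \<open>The type space is a Boolean space\<close>

lemma type_cyl_tautology: "type_cyl U x A tautology = types U x A"
  using types_entails[of _ U x A "{}" tautology] by (auto simp: type_cyl_def)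

lemma type_cyl_Neg:
  "\<phi> \<in> forms U x A \<Longrightarrow> type_cyl U x A (Neg \<phi>) = types U x A - type_cyl U x A \<phi>"
  using types_Neg_iff[of _ U x A \<phi>] by (auto simp: type_cyl_def)

lemma type_cyl_Conj:
  "\<phi> \<in> forms U x A \<Longrightarrow> \<psi> \<in> forms U x A \<Longrightarrow>
   type_cyl U x A (Conj \<phi> \<psi>) = type_cyl U x A \<phi> \<inter> type_cyl U x A \<psi>"
  using types_Conj_iff[of _ U x A \<phi> \<psi>] by (auto simp: type_cyl_def)

lemma topspace_type_space [simp]: "topspace (type_space U x A) = types U x A"
proof -
  have "types U x A \<subseteq> \<Union> (type_cyl U x A ` forms U x A)"
    using type_cyl_tautology[of U x A] tautology_in_forms[of U x A] by blast
  then show ?thesis by (auto simp: type_space_def type_cyl_def)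
qed

lemma openin_type_cyl: "\<phi> \<in> forms U x A \<Longrightarrow> openin (type_space U x A) (type_cyl U x A \<phi>)"
  unfolding type_space_def by (intro topology_generated_by_Basis) auto

lemma type_space_basic_nhd:
  assumes "openin (type_space U x A) G" "p \<in> G"
  shows "\<exists>\<phi>\<in>forms U x A. p \<in> type_cyl U x A \<phi> \<and> type_cyl U x A \<phi> \<subseteq> G"
proof -
  have "generate_topology_on (type_cyl U x A ` forms U x A) G"
    using assms(1) openin_topology_generated_by unfolding type_space_def by auto
  then show ?thesis using assms(2)
  proof (induction)
    case (Int a b)
    then obtain \<phi> \<psi> where "\<phi> \<in> forms U x A" "p \<in> type_cyl U x A \<phi>" "type_cyl U x A \<phi> \<subseteq> a"
      "\<psi> \<in> forms U x A" "p \<in> type_cyl U x A \<psi>" "type_cyl U x A \<psi> \<subseteq> b" by blast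
    then show ?case by (intro bexI[of _ "Conj \<phi> \<psi>"]) (auto simp: type_cyl_Conj)
  next
    case (UN K)
    then show ?case by blast
  qed auto
qed

lemma algebra_type_cyl: "algebra (types U x A) (type_cyl U x A ` forms U x A)"
  unfolding algebra_iff_Int
proof (intro conjI ballI)
  show "type_cyl U x A ` forms U x A \<subseteq> Pow (types U x A)" by (auto simp: type_cyl_def)
  show "{} \<in> type_cyl U x A ` forms U x A"
    by (rule image_eqI[of _ _ "Neg tautology"]) (auto simp: type_cyl_Neg type_cyl_tautology)
  show "types U x A - a \<in> type_cyl U x A ` forms U x A" if a: "a \<in> type_cyl U x A ` forms U x A" for a
  proof -
    obtain \<phi> where "\<phi> \<in> forms U x A" "a = type_cyl U x A \<phi>" using a by blast
    then show ?thesis by (intro image_eqI[of _ _ "Neg \<phi>"]) (auto simp: type_cyl_Neg)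
  qed
  show "a \<inter> b \<in> type_cyl U x A ` forms U x A"
    if a: "a \<in> type_cyl U x A ` forms U x A" "b \<in> type_cyl U x A ` forms U x A" for a b
  proof -
    obtain \<phi> \<psi> where "\<phi> \<in> forms U x A" "a = type_cyl U x A \<phi>" "\<psi> \<in> forms U x A" "b = type_cyl U x A \<psi>"
      using a by blast
    then show ?thesis by (intro image_eqI[of _ _ "Conj \<phi> \<psi>"]) (auto simp: type_cyl_Conj)
  qed
qed

text \<open>If no finite part of a cover covers, then the negations of the formulas whose cylinders lie in
members of the cover are finitely satisfiable, and a type extending them is not covered.\<close>

lemma compact_type_space: "compact_space (type_space U x A)"
  unfolding compact_space_def compactin_def topspace_type_space
proof (intro conjI allI impI subset_refl)
  fix \<U> assume \<U>: "(\<forall>G\<in>\<U>. openin (type_space U x A) G) \<and> types U x A \<subseteq> \<Union>\<U>"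
  define \<Phi> where "\<Phi> = {\<phi>\<in>forms U x A. \<exists>G\<in>\<U>. type_cyl U x A \<phi> \<subseteq> G}"
  show "\<exists>\<F>. finite \<F> \<and> \<F> \<subseteq> \<U> \<and> types U x A \<subseteq> \<Union>\<F>"
  proof (cases "fin_sat U (Neg ` \<Phi>)")
    case True
    have "Neg ` \<Phi> \<subseteq> forms U x A" by (auto simp: \<Phi>_def)
    from fin_sat_extends_to_type[OF this True]
    obtain p where p: "p \<in> types U x A" "Neg ` \<Phi> \<subseteq> p" by blast
    then obtain G where G: "G \<in> \<U>" "p \<in> G" using \<U> by blast
    with \<U> type_space_basic_nhd[of U x A G p]
    obtain \<phi> where \<phi>: "\<phi> \<in> forms U x A" "p \<in> type_cyl U x A \<phi>" "type_cyl U x A \<phi> \<subseteq> G" by blast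
    then have "Neg \<phi> \<in> p" using p G by (auto simp: \<Phi>_def)
    then show ?thesis using \<phi>(1,2) types_Neg_iff[OF p(1)] by (auto simp: type_cyl_def)
  next
    case False
    then obtain P where P: "finite P" "P \<subseteq> Neg ` \<Phi>" "\<not> (\<exists>e. \<forall>\<phi>\<in>P. sat U e \<phi>)"
      unfolding fin_sat_def by blast
    then obtain Q where Q: "Q \<subseteq> \<Phi>" "finite Q" "P = Neg ` Q"
      by (meson finite_subset_image)
    have "\<forall>\<phi>\<in>Q. \<exists>G\<in>\<U>. type_cyl U x A \<phi> \<subseteq> G" using Q(1) by (auto simp: \<Phi>_def)
    then obtain g where g: "\<And>\<phi>. \<phi> \<in> Q \<Longrightarrow> g \<phi> \<in> \<U> \<and> type_cyl U x A \<phi> \<subseteq> g \<phi>" by metis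
    have "types U x A \<subseteq> \<Union>(g ` Q)"
    proof
      fix p assume p: "p \<in> types U x A"
      have "\<not> Neg ` Q \<subseteq> p" using types_sat[OF p, of P] P Q by blast
      then obtain \<phi> where \<phi>: "\<phi> \<in> Q" "Neg \<phi> \<notin> p" by blast
      then have "\<phi> \<in> p" using types_Neg_iff[OF p, of \<phi>] Q(1) by (auto simp: \<Phi>_def)
      then show "p \<in> \<Union>(g ` Q)" using g[OF \<phi>(1)] \<phi>(1) p by (auto simp: type_cyl_def)
    qed
    then show ?thesis using g Q(2) by (intro exI[of _ "g ` Q"]) auto
  qed
qed

lemma clopen_basis_type_space:
  "clopen_basis (type_space U x A) (type_cyl U x A ` forms U x A)"
proof -
  interpret algebra "topspace (type_space U x A)" "type_cyl U x A ` forms U x A"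
    using algebra_type_cyl by simp
  show ?thesis
  proof
    show "compact_space (type_space U x A)" by (rule compact_type_space)
    show "openin (type_space U x A) a" if "a \<in> type_cyl U x A ` forms U x A" for a
      using that openin_type_cyl by blast
    show "\<exists>a\<in>type_cyl U x A ` forms U x A. p \<in> a \<and> a \<subseteq> G" if "openin (type_space U x A) G" "p \<in> G" for G p
      using type_space_basic_nhd[OF that] by blast
  qed
qed

section \<open>The measure on the type space\<close>

text \<open>Formulas with the same cylinder are equivalent in \<open>U\<close>, because each assignment has a type. Hence a
Keisler measure induces a function on cylinders.\<close>

lemma type_cyl_mono_imp:
  assumes "\<phi> \<in> forms U x A" "\<psi> \<in> forms U x A" "type_cyl U x A \<phi> \<subseteq> type_cyl U x A \<psi>" "sat U e \<phi>"
  shows "sat U e \<psi>"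
proof -
  let ?p = "tp U x A (map e x)"
  have "?p \<in> types U x A" by (intro tp_in_types) simp
  then show ?thesis
    using assms holds_inst_map[OF forms_fv, of \<phi> U x A] holds_inst_map[OF forms_fv, of \<psi> U x A]
    by (auto simp: type_cyl_def in_tp_iff)
qed

lemma keisler_cong:
  assumes "\<mu> \<in> keisler U x A" "\<phi> \<in> forms U x A" "\<psi> \<in> forms U x A" "\<And>e. sat U e \<phi> \<longleftrightarrow> sat U e \<psi>"
  shows "\<mu> \<phi> = \<mu> \<psi>"
  using assms unfolding keisler_def by blast

lemma keisler_nonneg: "\<mu> \<in> keisler U x A \<Longrightarrow> \<phi> \<in> forms U x A \<Longrightarrow> 0 \<le> \<mu> \<phi>"
  unfolding keisler_def by blast

lemma keisler_holds: "\<mu> \<in> keisler U x A \<Longrightarrow> \<phi> \<in> forms U x A \<Longrightarrow> holds U \<phi> \<Longrightarrow> \<mu> \<phi> = 1"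
  unfolding keisler_def by blast

lemma keisler_disjoint_add:
  assumes "\<mu> \<in> keisler U x A" "\<phi> \<in> forms U x A" "\<psi> \<in> forms U x A" "\<And>e. \<not> (sat U e \<phi> \<and> sat U e \<psi>)"
  shows "\<mu> (Neg (Conj (Neg \<phi>) (Neg \<psi>))) = \<mu> \<phi> + \<mu> \<psi>"
  using assms unfolding keisler_def by blast

text \<open>The definite description in \<open>type_measure\<close> is justified here: the Keisler measure is a content on
the clopen basis of cylinders, which has exactly one regular extension.\<close>

lemma type_measure_spec:
  assumes \<mu>: "\<mu> \<in> keisler U x UNIV"
  shows "regular_borel_prob (type_space U x N) (type_measure U x N \<mu>)"
    and "\<And>\<phi>. \<phi> \<in> forms U x N \<Longrightarrow> measure (type_measure U x N \<mu>) (type_cyl U x N \<phi>) = \<mu> \<phi>"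
proof -
  let ?X = "type_space U x N" and ?\<A> = "type_cyl U x N ` forms U x N"
  \<comment> \<open>The choice of the formula is immaterial, since formulas with equal cylinders are equivalent.\<close>
  define c where "c a = \<mu> (SOME \<phi>. \<phi> \<in> forms U x N \<and> type_cyl U x N \<phi> = a)" for a
  have c: "c (type_cyl U x N \<phi>) = \<mu> \<phi>" if \<phi>: "\<phi> \<in> forms U x N" for \<phi>
  proof -
    define \<psi> where "\<psi> = (SOME \<psi>. \<psi> \<in> forms U x N \<and> type_cyl U x N \<psi> = type_cyl U x N \<phi>)"
    have \<psi>: "\<psi> \<in> forms U x N" "type_cyl U x N \<psi> = type_cyl U x N \<phi>"
      using someI[of "\<lambda>\<psi>. \<psi> \<in> forms U x N \<and> type_cyl U x N \<psi> = type_cyl U x N \<phi>" \<phi>] \<phi>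
      unfolding \<psi>_def by auto
    have "\<mu> \<psi> = \<mu> \<phi>"
      using \<phi> \<psi> type_cyl_mono_imp[of \<psi> U x N \<phi>] type_cyl_mono_imp[of \<phi> U x N \<psi>]
      by (intro keisler_cong[OF \<mu>]) (auto intro: forms_UNIV)
    then show ?thesis by (simp add: c_def \<psi>_def)
  qed
  interpret B: clopen_basis ?X ?\<A> by (rule clopen_basis_type_space)
  interpret content ?X ?\<A> c
  proof
    show "0 \<le> c a" if "a \<in> ?\<A>" for a
      using that keisler_nonneg[OF \<mu>] by (auto simp: c forms_UNIV)
    have "\<mu> tautology = 1" using \<mu> by (intro keisler_holds) (auto simp: holds_def)
    then show "c (topspace ?X) = 1"
      using c[OF tautology_in_forms] by (simp add: type_cyl_tautology)
    fix a b assume ab: "a \<in> ?\<A>" "b \<in> ?\<A>" "a \<inter> b = {}"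
    then obtain \<phi> \<psi> where \<phi>\<psi>: "\<phi> \<in> forms U x N" "\<psi> \<in> forms U x N" "a = type_cyl U x N \<phi>" "b = type_cyl U x N \<psi>"
      by blast
    \<comment> \<open>Disjoint cylinders belong to formulas that exclude each other: their conjunction has an empty
      cylinder, hence implies a contradiction.\<close>
    have "type_cyl U x N (Conj \<phi> \<psi>) \<subseteq> type_cyl U x N (Neg tautology)"
      using ab \<phi>\<psi> by (simp add: type_cyl_Conj)
    then have disj: "\<not> (sat U e \<phi> \<and> sat U e \<psi>)" for e
      using type_cyl_mono_imp[of "Conj \<phi> \<psi>" U x N "Neg tautology" e] \<phi>\<psi> by auto
    have "a \<union> b = type_cyl U x N (Neg (Conj (Neg \<phi>) (Neg \<psi>)))"
      using \<phi>\<psi> by (simp add: type_cyl_Neg type_cyl_Conj) (auto simp: type_cyl_def)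
    then show "c (a \<union> b) = c a + c b"
      using \<phi>\<psi> disj keisler_disjoint_add[OF \<mu> forms_UNIV forms_UNIV, of \<phi> N \<psi> N] by (simp add: c)
  qed
  let ?P = "\<lambda>m. regular_borel_prob ?X m \<and> (\<forall>\<phi>\<in>forms U x N. measure m (type_cyl U x N \<phi>) = \<mu> \<phi>)"
  have "\<exists>!m. ?P m"
  proof (rule ex_ex1I)
    show "\<exists>m. ?P m" using regular_borel_extension_exists c by auto
    fix m m' assume m: "?P m" "?P m'"
    have uniq: "distr m1 (borel_sets ?X) id = m2" if "?P m1" "?P m2" for m1 m2
    proof (rule distr_regular_borel_prob_eq[OF clopen_basis_type_space])
      show "measure m1 (id -` a \<inter> topspace ?X) = measure m2 a" if "a \<in> ?\<A>" for a
      proof -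
        have "a \<inter> types U x N = a" using that by (auto simp: type_cyl_def)
        then show ?thesis using that \<open>?P m1\<close> \<open>?P m2\<close> by auto
      qed
    qed (use that compact_type_space in auto)
    have "m = distr m (borel_sets ?X) id" using uniq[OF m(1) m(1)] ..
    also have "\<dots> = m'" using uniq[OF m] .
    finally show "m = m'" .
  qed
  from theI'[OF this] have "?P (type_measure U x N \<mu>)" unfolding type_measure_def .
  then show "regular_borel_prob ?X (type_measure U x N \<mu>)"
    and "\<And>\<phi>. \<phi> \<in> forms U x N \<Longrightarrow> measure (type_measure U x N \<mu>) (type_cyl U x N \<phi>) = \<mu> \<phi>"
    by auto
qed

section \<open>Instantiation as a map of type spaces\<close>

text \<open>The continuous map sending the type of \<open>b\<close> over \<open>N\<close> to the type of \<open>(b, c)\<close> over \<open>M\<close>, for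
\<open>M \<subseteq> N\<close> and \<open>c\<close> from \<open>N\<close>. With \<open>z = c = []\<close> it is the restriction of types to the smaller set.\<close>

definition type_pull :: "('f, 'r, 'a) struct \<Rightarrow> nat list \<Rightarrow> nat list \<Rightarrow> 'a list \<Rightarrow> 'a set \<Rightarrow>
    ('f, 'r, 'a) fm set \<Rightarrow> ('f, 'r, 'a) fm set" where
  "type_pull U y z c M q = {\<psi> \<in> forms U (y @ z) M. inst z c \<psi> \<in> q}"

context
  fixes U :: "('f, 'r, 'a) struct" and y z :: "nat list" and c :: "'a list" and M N :: "'a set"
  assumes MN: "M \<subseteq> N" and c: "c \<in> tuples z N"
begin

lemma inst_in_forms_pull: "\<psi> \<in> forms U (y @ z) M \<Longrightarrow> inst z c \<psi> \<in> forms U y N"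
  using inst_in_forms[of \<psi> U "y @ z" M c z N y N] c MN by auto

lemma type_pull_in_types:
  assumes q: "q \<in> types U y N"
  shows "type_pull U y z c M q \<in> types U (y @ z) M"
  unfolding types_def
proof (intro CollectI conjI allI impI ballI)
  show "type_pull U y z c M q \<subseteq> forms U (y @ z) M" by (auto simp: type_pull_def)
  show "\<exists>e. \<forall>\<phi>\<in>P. sat U e \<phi>" if "finite P \<and> P \<subseteq> type_pull U y z c M q" for P
  proof -
    have "finite (inst z c ` P)" "inst z c ` P \<subseteq> q" using that by (auto simp: type_pull_def)
    then obtain e where "\<forall>\<phi>\<in>inst z c ` P. sat U e \<phi>" using types_sat[OF q] by blast
    then have "\<forall>\<phi>\<in>P. sat U (assign_tuple z c e) \<phi>" by (simp add: sat_inst)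
    then show ?thesis by blast
  qed
  show "\<phi> \<in> type_pull U y z c M q \<or> Neg \<phi> \<in> type_pull U y z c M q" if \<phi>: "\<phi> \<in> forms U (y @ z) M" for \<phi>
    using types_Neg_iff[OF q inst_in_forms_pull[OF \<phi>]] \<phi> by (auto simp: type_pull_def)
qed

lemma type_pull_vimage_cyl:
  assumes "\<psi> \<in> forms U (y @ z) M"
  shows "type_pull U y z c M -` type_cyl U (y @ z) M \<psi> \<inter> types U y N = type_cyl U y N (inst z c \<psi>)"
  using assms type_pull_in_types by (auto simp: type_cyl_def) (auto simp: type_pull_def)

lemma continuous_type_pull:
  "continuous_map (type_space U y N) (type_space U (y @ z) M) (type_pull U y z c M)"
  unfolding type_space_def[of U "y @ z"]
proof (rule continuous_on_generated_topo)
  show "openin (type_space U y N) (type_pull U y z c M -` a \<inter> topspace (type_space U y N))"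
    if a: "a \<in> type_cyl U (y @ z) M ` forms U (y @ z) M" for a
    using a by (auto simp: type_pull_vimage_cyl intro!: openin_type_cyl inst_in_forms_pull)
  have "\<Union> (type_cyl U (y @ z) M ` forms U (y @ z) M) = types U (y @ z) M"
    using topspace_type_space[of U "y @ z" M] unfolding type_space_def by simp
  then show "type_pull U y z c M ` topspace (type_space U y N) \<subseteq> \<Union> (type_cyl U (y @ z) M ` forms U (y @ z) M)"
    using type_pull_in_types by auto
qed

lemma realizes_type_pull:
  assumes "realizes U y b q" "set y \<inter> set z = {}"
  shows "realizes U (y @ z) (b @ c) (type_pull U y z c M q)"
  using assms c by (auto simp: realizes_def tuples_def type_pull_def inst_append)

end

section \<open>Fibers\<close>

text \<open>The value of a fiber does not depend on the realization, also for formulas with parameters \<open>c\<close> from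
\<open>N\<close>: if \<open>b\<close> and \<open>b'\<close> have the same type over \<open>N\<close>, then \<open>(b, c)\<close> and \<open>(b', c)\<close> have the same type
over \<open>M\<close>, to which invariance applies.\<close>

lemma fiber_eq:
  assumes inv: "invariant U x M \<mu>" and "M \<subseteq> N" and xy: "distinct y" "set x \<inter> set y = {}"
    and \<phi>: "\<phi> \<in> forms U (x @ y) N" and q: "q \<in> types U y N" and b: "realizes U y b q"
  shows "fiber U y \<mu> \<phi> q = \<mu> (inst y b \<phi>)"
proof -
  obtain z c \<phi>\<^sub>0 where z: "distinct z" "set z \<inter> set (x @ y) = {}" "c \<in> tuples z N"
    "\<phi>\<^sub>0 \<in> forms U ((x @ y) @ z) {}" "\<phi> = inst z c \<phi>\<^sub>0"
    using parameters_as_instance[OF \<phi>] .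
  define b' where "b' = (SOME b. realizes U y b q)"
  have b': "realizes U y b' q" unfolding b'_def using b by (rule someI)
  have yz: "set y \<inter> set z = {}" using z(2) by auto
  have tp: "tp U (y @ z) M (a @ c) = type_pull U y z c M q" if "realizes U y a q" for a
    using type_pull_in_types[OF \<open>M \<subseteq> N\<close> z(3) q] realizes_type_pull[OF \<open>M \<subseteq> N\<close> z(3) that yz]
    by (intro realizes_tp_eq) auto
  have tup: "a @ c \<in> tuples (y @ z) UNIV" if "realizes U y a q" for a
    using that z(3) by (auto simp: realizes_def tuples_def)
  have ap: "inst (y @ z) (a @ c) \<phi>\<^sub>0 = inst y a \<phi>" if "realizes U y a q" for a
    using that z yz by (subst inst_append) (auto simp: realizes_def tuples_def)
  have "set x \<inter> set (y @ z) = {}" using z(2) xy by auto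
  then have "\<mu> (inst (y @ z) (b' @ c) \<phi>\<^sub>0) = \<mu> (inst (y @ z) (b @ c) \<phi>\<^sub>0)"
    using inv[unfolded invariant_def, rule_format, of "y @ z" \<phi>\<^sub>0 "b' @ c" "b @ c"] tp tup b b' z xy yz
    by auto
  then show ?thesis unfolding fiber_def b'_def[symmetric] ap[OF b] ap[OF b'] .
qed

lemma saturated_realizes:
  assumes "saturated \<kappa> U" "|N| <o \<kappa>" "distinct y" "q \<in> types U y N"
  shows "\<exists>b. realizes U y b q"
  using assms(1)[unfolded saturated_def, rule_format, of N y q] assms(2-4) by simp

lemma fiber_type_pull:
  assumes inv: "invariant U x M\<^sub>0 \<mu>" and M: "M\<^sub>0 \<subseteq> M" "M \<subseteq> N"
    and sat: "saturated \<kappa> U" "|N| <o \<kappa>"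
    and d: "distinct (y @ z)" "set x \<inter> set (y @ z) = {}"
    and c: "c \<in> tuples z N" and \<phi>: "\<phi> \<in> forms U (x @ y @ z) M" and q: "q \<in> types U y N"
  shows "fiber U y \<mu> (inst z c \<phi>) q = fiber U (y @ z) \<mu> \<phi> (type_pull U y z c M q)"
proof -
  have dy: "distinct y" using d by simp
  obtain b where b: "realizes U y b q" using saturated_realizes[OF sat dy q] ..
  have "inst z c \<phi> \<in> forms U (x @ y) N"
    using inst_in_forms[OF \<phi> c, of "x @ y" N] M by auto
  then have "fiber U y \<mu> (inst z c \<phi>) q = \<mu> (inst y b (inst z c \<phi>))"
    using d M by (intro fiber_eq[OF inv _ _ _ _ q b]) auto
  also have "\<dots> = \<mu> (inst (y @ z) (b @ c) \<phi>)"
    using b c d by (subst inst_append) (auto simp: realizes_def tuples_def)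
  also have "\<dots> = fiber U (y @ z) \<mu> \<phi> (type_pull U y z c M q)"
    using d \<phi> M type_pull_in_types[OF M(2) c q] realizes_type_pull[OF M(2) c b]
    by (intro fiber_eq[OF inv M(1), symmetric]) auto
  finally show ?thesis .
qed

text \<open>Every fiber over \<open>N\<close> is the fiber of a parameter-free formula over \<open>M\<close>, composed with a continuous
map of type spaces. This transfers measurability and continuity from the parameter-free formulas
over \<open>M\<close> to all formulas over larger sets.\<close>

lemma fiber_factors:
  assumes inv: "invariant U x M \<mu>" "M \<subseteq> N" and sat: "saturated \<kappa> U" "|N| <o \<kappa>"
    and d: "distinct y" "set x \<inter> set y = {}" and \<phi>: "\<phi> \<in> forms U (x @ y) N"
  obtains z c \<phi>\<^sub>0 where "distinct (y @ z)" "set x \<inter> set (y @ z) = {}" "c \<in> tuples z N"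
    "\<phi>\<^sub>0 \<in> forms U (x @ y @ z) {}"
    "\<forall>q\<in>types U y N. fiber U y \<mu> \<phi> q = fiber U (y @ z) \<mu> \<phi>\<^sub>0 (type_pull U y z c M q)"
proof -
  obtain z c \<phi>\<^sub>0 where z: "distinct z" "set z \<inter> set (x @ y) = {}" "c \<in> tuples z N"
    "\<phi>\<^sub>0 \<in> forms U ((x @ y) @ z) {}" "\<phi> = inst z c \<phi>\<^sub>0"
    using parameters_as_instance[OF \<phi>] .
  have dyz: "distinct (y @ z)" "set x \<inter> set (y @ z) = {}" using z d by auto
  have \<phi>\<^sub>0: "\<phi>\<^sub>0 \<in> forms U (x @ y @ z) M" using z(4) by (auto simp: forms_def)
  show ?thesis
  proof (rule that[OF dyz z(3)])
    show "\<phi>\<^sub>0 \<in> forms U (x @ y @ z) {}" using z(4) by simp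
    show "\<forall>q\<in>types U y N. fiber U y \<mu> \<phi> q = fiber U (y @ z) \<mu> \<phi>\<^sub>0 (type_pull U y z c M q)"
    proof
      fix q assume "q \<in> types U y N"
      from fiber_type_pull[OF inv(1) subset_refl inv(2) sat dyz z(3) \<phi>\<^sub>0 this]
      show "fiber U y \<mu> \<phi> q = fiber U (y @ z) \<mu> \<phi>\<^sub>0 (type_pull U y z c M q)"
        unfolding z(5) .
    qed
  qed
qed

lemma fiber_borel_measurable:
  assumes bd: "borel_definable_over \<kappa> U x M \<mu>" "M \<subseteq> N" and sat: "saturated \<kappa> U" "|N| <o \<kappa>"
    and d: "distinct y" "set x \<inter> set y = {}" and \<phi>: "\<phi> \<in> forms U (x @ y) N"
  shows "fiber U y \<mu> \<phi> \<in> borel_measurable (borel_sets (type_space U y N))"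
proof -
  have inv: "invariant U x M \<mu>" using bd(1) by (simp add: borel_definable_over_def)
  obtain z c \<phi>\<^sub>0 where z: "distinct (y @ z)" "set x \<inter> set (y @ z) = {}" "c \<in> tuples z N"
    "\<phi>\<^sub>0 \<in> forms U (x @ y @ z) {}"
    and eq: "\<forall>q\<in>types U y N. fiber U y \<mu> \<phi> q = fiber U (y @ z) \<mu> \<phi>\<^sub>0 (type_pull U y z c M q)"
    using fiber_factors[OF inv bd(2) sat d \<phi>] .
  have "fiber U (y @ z) \<mu> \<phi>\<^sub>0 \<in> borel_measurable (borel_sets (type_space U (y @ z) M))"
    using bd(1) z by (simp add: borel_definable_over_def)
  from measurable_comp[OF continuous_map_measurable_borel_sets[OF continuous_type_pull[OF bd(2) z(3)]] this]
  show ?thesis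
    by (rule measurable_cong[THEN iffD2, rotated]) (simp add: eq)
qed

lemma fiber_continuous:
  assumes bd: "definable_over \<kappa> U x M \<mu>" "M \<subseteq> N" and sat: "saturated \<kappa> U" "|N| <o \<kappa>"
    and d: "distinct y" "set x \<inter> set y = {}" and \<phi>: "\<phi> \<in> forms U (x @ y) N"
  shows "continuous_map (type_space U y N) euclideanreal (fiber U y \<mu> \<phi>)"
proof -
  have inv: "invariant U x M \<mu>" using bd(1) by (simp add: definable_over_def)
  obtain z c \<phi>\<^sub>0 where z: "distinct (y @ z)" "set x \<inter> set (y @ z) = {}" "c \<in> tuples z N"
    "\<phi>\<^sub>0 \<in> forms U (x @ y @ z) {}"
    and eq: "\<forall>q\<in>types U y N. fiber U y \<mu> \<phi> q = fiber U (y @ z) \<mu> \<phi>\<^sub>0 (type_pull U y z c M q)"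
    using fiber_factors[OF inv bd(2) sat d \<phi>] .
  have "continuous_map (type_space U (y @ z) M) euclideanreal (fiber U (y @ z) \<mu> \<phi>\<^sub>0)"
    using bd(1) z by (simp add: definable_over_def)
  from continuous_map_compose[OF continuous_type_pull[OF bd(2) z(3)] this]
  show ?thesis
    by (rule continuous_map_eq) (simp add: eq)
qed

lemma definable_over_imp_borel:
  "definable_over \<kappa> U x M \<mu> \<Longrightarrow> borel_definable_over \<kappa> U x M \<mu>"
  by (simp add: definable_over_def borel_definable_over_def continuous_map_real_measurable_borel_sets)

text \<open>Restriction of types maps the measure on \<open>S\<^sub>y(N')\<close> to the one on \<open>S\<^sub>y(N)\<close>, since both give a cylinder
the measure of its formula, and it carries the fiber over \<open>N\<close> to the fiber over \<open>N'\<close>.\<close>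

lemma fiber_integral_indep:
  assumes bd: "borel_definable_over \<kappa> U x M \<mu>" "M \<subseteq> N" "N \<subseteq> N'" and sat: "saturated \<kappa> U" "|N'| <o \<kappa>"
    and d: "distinct y" "set x \<inter> set y = {}" and \<phi>: "\<phi> \<in> forms U (x @ y) N"
    and \<nu>: "\<nu> \<in> keisler U y UNIV"
  shows "(\<integral>q. fiber U y \<mu> \<phi> q \<partial>type_measure U y N \<nu>) = (\<integral>q. fiber U y \<mu> \<phi> q \<partial>type_measure U y N' \<nu>)"
proof -
  let ?r = "type_pull U y [] [] N"
  let ?X = "type_space U y N" and ?X' = "type_space U y N'"
  let ?m = "type_measure U y N \<nu>" and ?m' = "type_measure U y N' \<nu>"
  have inv: "invariant U x M \<mu>" using bd(1) by (simp add: borel_definable_over_def)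
  have nil: "[] \<in> tuples [] N'" by (simp add: tuples_def)
  have sN: "|N| <o \<kappa>" using sat(2) bd(3) card_of_mono1 ordLeq_ordLess_trans by blast
  have reg': "regular_borel_prob ?X' ?m'" and reg: "regular_borel_prob ?X ?m"
    using type_measure_spec[OF \<nu>] by auto
  have cont: "continuous_map ?X' ?X ?r" using continuous_type_pull[OF bd(3) nil, of U y] by simp
  have "distr ?m' (borel_sets ?X) ?r = ?m"
  proof (rule distr_regular_borel_prob_eq[OF clopen_basis_type_space reg reg' compact_type_space cont])
    fix a assume "a \<in> type_cyl U y N ` forms U y N"
    then obtain \<psi> where \<psi>: "\<psi> \<in> forms U y N" "a = type_cyl U y N \<psi>" by blast
    then have "?r -` a \<inter> types U y N' = type_cyl U y N' \<psi>"
      using type_pull_vimage_cyl[OF bd(3) nil, of \<psi> U y] by simp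
    then show "measure ?m' (?r -` a \<inter> topspace ?X') = measure ?m a"
      using \<psi> type_measure_spec(2)[OF \<nu>] forms_mono[OF \<psi>(1) subset_refl bd(3)] by simp
  qed
  then have "(\<integral>q. fiber U y \<mu> \<phi> q \<partial>?m) = (\<integral>q. fiber U y \<mu> \<phi> q \<partial>distr ?m' (borel_sets ?X) ?r)" by simp
  also have "\<dots> = (\<integral>q. fiber U y \<mu> \<phi> (?r q) \<partial>?m')"
  proof (rule integral_distr)
    show "?r \<in> measurable ?m' (borel_sets ?X)"
      using continuous_map_measurable_borel_sets[OF cont] reg'
      by (auto simp: regular_borel_prob_def cong: measurable_cong_sets)
    show "fiber U y \<mu> \<phi> \<in> borel_measurable (borel_sets ?X)"
      by (rule fiber_borel_measurable[OF bd(1,2) sat(1) sN d \<phi>])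
  qed
  also have "\<dots> = (\<integral>q. fiber U y \<mu> \<phi> q \<partial>?m')"
  proof (rule Bochner_Integration.integral_cong[OF refl])
    fix q assume "q \<in> space ?m'"
    then have "q \<in> types U y N'"
      using reg' sets_eq_imp_space_eq[of ?m' "borel_sets ?X'"] by (simp add: regular_borel_prob_def)
    then show "fiber U y \<mu> \<phi> (?r q) = fiber U y \<mu> \<phi> q"
      using fiber_type_pull[OF inv bd(2,3) sat, of y "[]" "[]" \<phi> q] d \<phi> nil by simp
  qed
  finally show ?thesis .
qed

section \<open>Small elementary submodels\<close>

text \<open>Lists over an infinite set are the countable union, over their lengths, of finite powers.\<close>

lemma card_of_lists_le:
  assumes B: "infinite B" and A: "|A| \<le>o |B|"
  shows "|lists A| \<le>o |B|"
proof -
  let ?L = "\<lambda>n. {xs \<in> lists A. length xs = n}"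
  have "|?L n| \<le>o |B|" for n
  proof (induction n)
    case 0
    have "?L 0 = {[]}" by auto
    then show ?case using B card_of_singl_ordLeq[of B "[]"] by (metis finite.emptyI)
  next
    case (Suc n)
    have "?L (Suc n) \<subseteq> (\<lambda>(a, xs). a # xs) ` (A \<times> ?L n)"
      by (auto simp: length_Suc_conv image_iff)
    then have "|?L (Suc n)| \<le>o |(\<lambda>(a, xs). a # xs) ` (A \<times> ?L n)|" by (rule card_of_mono1)
    also have "|(\<lambda>(a, xs). a # xs) ` (A \<times> ?L n)| \<le>o |A \<times> ?L n|" by (rule card_of_image)
    also have "|A \<times> ?L n| \<le>o |B|" by (intro card_of_Sigma_ordLeq_infinite[OF B A] ballI Suc)
    finally show ?case .
  qed
  moreover have "|UNIV :: nat set| \<le>o |B|" using B infinite_iff_card_of_nat by blast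
  ultimately have "|\<Union>n\<in>UNIV. ?L n| \<le>o |B|" using B by (intro card_of_UNION_ordLeq_infinite) auto
  moreover have "(\<Union>n\<in>UNIV. ?L n) = lists A" by auto
  ultimately show ?thesis by simp
qed

lemma countable_imp_card_of_le_infinite:
  assumes "countable K" "infinite B"
  shows "|K| \<le>o |B|"
proof -
  obtain f :: "'a \<Rightarrow> nat" where "inj_on f K" using assms(1) by (auto simp: countable_def)
  then have "|K| \<le>o |UNIV :: nat set|" using card_of_ordLeq[of K "UNIV :: nat set"] by blast
  also have "|UNIV :: nat set| \<le>o |B|" using assms(2) infinite_iff_card_of_nat by blast
  finally show ?thesis .
qed

text \<open>Adding all values of the operations, countably often, suffices because each operation only takes
finitely many arguments. The disjoint union in the bound provides an infinite set also when \<open>'a\<close>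
is finite.\<close>

lemma closure_under_countably_many_operations:
  fixes K :: "('a list \<Rightarrow> 'a) set"
  assumes K: "countable K"
  obtains N where "A \<subseteq> N" "|N| \<le>o |A <+> (UNIV :: nat set)|"
    "\<And>f as. f \<in> K \<Longrightarrow> set as \<subseteq> N \<Longrightarrow> f as \<in> N"
proof -
  define C where "C = rec_nat A (\<lambda>_ B. B \<union> (\<lambda>(f, as). f as) ` (K \<times> lists B))"
  have C0: "C 0 = A" and CS: "C (Suc n) = C n \<union> (\<lambda>(f, as). f as) ` (K \<times> lists (C n))" for n
    by (simp_all add: C_def)
  let ?B = "A <+> (UNIV :: nat set)"
  have B: "infinite ?B" by simp
  have card: "|C n| \<le>o |?B|" for n
  proof (induction n)
    case 0
    show ?case unfolding C0 by (rule card_of_Plus1)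
  next
    case (Suc n)
    have "|(\<lambda>(f, as). f as) ` (K \<times> lists (C n))| \<le>o |K \<times> lists (C n)|" by (rule card_of_image)
    also have "|K \<times> lists (C n)| \<le>o |?B|"
      by (intro card_of_Sigma_ordLeq_infinite[OF B countable_imp_card_of_le_infinite[OF K B]]
          ballI card_of_lists_le[OF B Suc])
    finally show ?case unfolding CS
      using Suc B by (intro card_of_Un_ordLeq_infinite_Field) (simp_all add: card_of_card_order_on Field_card_of)
  qed
  have mono: "mono C" by (rule mono_iff_le_Suc[THEN iffD2]) (simp add: CS)
  have fin: "\<exists>n. set as \<subseteq> C n" if "set as \<subseteq> (\<Union>n. C n)" for as
    using that
  proof (induction as)
    case (Cons a as)
    then obtain m n where "a \<in> C m" "set as \<subseteq> C n" by auto
    moreover have "C m \<subseteq> C (max m n)" "C n \<subseteq> C (max m n)" using mono by (auto simp: mono_def)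
    ultimately have "set (a # as) \<subseteq> C (max m n)" by auto
    then show ?case ..
  qed simp
  show ?thesis
  proof (rule that[of "\<Union>n. C n"])
    show "A \<subseteq> (\<Union>n. C n)" using C0 by blast
    have "|UNIV :: nat set| \<le>o |?B|" using B infinite_iff_card_of_nat by blast
    then show "|\<Union>n. C n| \<le>o |?B|" using B card by (intro card_of_UNION_ordLeq_infinite) auto
    show "f as \<in> (\<Union>n. C n)" if f: "f \<in> K" and as: "set as \<subseteq> (\<Union>n. C n)" for f as
    proof -
      obtain n where "set as \<subseteq> C n" using fin[OF as] ..
      then have "(f, as) \<in> K \<times> lists (C n)" using f by auto
      then have "f as \<in> C (Suc n)" unfolding CS by force
      then show ?thesis by blast
    qed
  qed
qed

lemma countable_terms:
  assumes L: "countable (funs L)"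
  shows "countable {t :: ('f, 'a) tm. wf_tm L t \<and> tm_params t = {}}"
proof -
  let ?S = "\<lambda>n. {t :: ('f, 'a) tm. wf_tm L t \<and> tm_params t = {} \<and> size t < n}"
  have "countable (?S n)" for n
  proof (induction n)
    case (Suc n)
    have "?S (Suc n) \<subseteq> range Var \<union> (\<lambda>(f, ts). Fn f ts) ` (funs L \<times> lists (?S n))"
    proof
      fix t assume t: "t \<in> ?S (Suc n)"
      show "t \<in> range Var \<union> (\<lambda>(f, ts). Fn f ts) ` (funs L \<times> lists (?S n))"
      proof (cases t)
        case (Fn f ts)
        have "size u < n" if "u \<in> set ts" for u
          using t Fn size_list_estimation'[OF that, of "size u" size] by simp
        then have "ts \<in> lists (?S n)" using t Fn by (auto simp: list_all_iff)
        then show ?thesis using t Fn by auto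
      qed (use t in auto)
    qed
    moreover have "countable (range Var \<union> (\<lambda>(f, ts). Fn f ts) ` (funs L \<times> lists (?S n)))"
      using Suc L by (intro countable_Un countable_image countable_SIGMA countable_lists) auto
    ultimately show ?case by (rule countable_subset)
  qed simp
  then have "countable (\<Union>n. ?S n)" by simp
  moreover have "(\<Union>n. ?S n) = {t. wf_tm L t \<and> tm_params t = {}}" by auto
  ultimately show ?thesis by simp
qed

lemma countable_formulas:
  assumes L: "countable_lang L"
  shows "countable {\<phi> :: ('f, 'r, 'a) fm. wf_fm L \<phi> \<and> params \<phi> = {}}"
proof -
  let ?T = "{t :: ('f, 'a) tm. wf_tm L t \<and> tm_params t = {}}"
  let ?S = "\<lambda>n. {\<phi> :: ('f, 'r, 'a) fm. wf_fm L \<phi> \<and> params \<phi> = {} \<and> size \<phi> < n}"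
  have T: "countable ?T" using L by (intro countable_terms) (simp add: countable_lang_def)
  have "countable (?S n)" for n
  proof (induction n)
    case (Suc n)
    let ?R = "(\<lambda>(s, t). Eq s t) ` (?T \<times> ?T) \<union> (\<lambda>(r, ts). Rel r ts) ` (rels L \<times> lists ?T)
      \<union> Neg ` ?S n \<union> (\<lambda>(\<phi>, \<psi>). Conj \<phi> \<psi>) ` (?S n \<times> ?S n) \<union> (\<lambda>(v, \<phi>). Ex v \<phi>) ` (UNIV \<times> ?S n)"
    have "?S (Suc n) \<subseteq> ?R"
    proof
      fix \<phi> assume \<phi>: "\<phi> \<in> ?S (Suc n)"
      show "\<phi> \<in> ?R"
      proof (cases \<phi>)
        case (Rel r ts)
        then have "ts \<in> lists ?T" "r \<in> rels L" using \<phi> by (auto simp: list_all_iff)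
        then show ?thesis using Rel by blast
      next
        case (Eq s t)
        then have "s \<in> ?T" "t \<in> ?T" using \<phi> by auto
        then show ?thesis using Eq by blast
      next
        case (Neg \<psi>)
        then have "\<psi> \<in> ?S n" using \<phi> by auto
        then show ?thesis using Neg by blast
      next
        case (Conj \<psi> \<psi>')
        then have "\<psi> \<in> ?S n" "\<psi>' \<in> ?S n" using \<phi> by auto
        then show ?thesis using Conj by blast
      next
        case (Ex v \<psi>)
        then have "\<psi> \<in> ?S n" using \<phi> by auto
        then show ?thesis using Ex by blast
      qed
    qed
    moreover have "countable ?R"
      using Suc L T
      by (intro countable_Un countable_image countable_SIGMA countable_lists) (auto simp: countable_lang_def)
    ultimately show ?case by (rule countable_subset)
  qed simp
  then have "countable (\<Union>n. ?S n)" by simp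
  moreover have "(\<Union>n. ?S n) = {\<phi>. wf_fm L \<phi> \<and> params \<phi> = {}}" by auto
  ultimately show ?thesis by simp
qed

lemma finite_fv [simp]: "finite (fv \<phi>)"
  by (induction \<phi>) auto

text \<open>The Tarski-Vaught test: existential quantifiers are the only obstacle, and the witness condition
removes it.\<close>

lemma Tarski_Vaught:
  fixes U :: "('f, 'r, 'a) struct"
  assumes "N \<noteq> {}" and "\<And>f as. f \<in> funs U \<Longrightarrow> set as \<subseteq> N \<Longrightarrow> fun_int U f as \<in> N"
    and wit: "\<And>\<phi> v e a. wf_fm U \<phi> \<Longrightarrow> params \<phi> = {} \<Longrightarrow> range e \<subseteq> N \<Longrightarrow> sat U (e(v := a)) \<phi> \<Longrightarrow>
      \<exists>b\<in>N. sat U (e(v := b)) \<phi>"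
  shows "elem_sub U N"
proof -
  have "sat_in U N e \<phi> \<longleftrightarrow> sat U e \<phi>" if "wf_fm U \<phi>" "params \<phi> = {}" "range e \<subseteq> N"
    for \<phi> :: "('f, 'r, 'a) fm" and e
    using that
  proof (induction \<phi> arbitrary: e)
    case (Ex v \<phi>)
    have "sat_in U N (e(v := a)) \<phi> \<longleftrightarrow> sat U (e(v := a)) \<phi>" if "a \<in> N" for a
      using Ex.prems that by (intro Ex.IH) auto
    then have "sat_in U N e (Ex v \<phi>) \<longleftrightarrow> (\<exists>a\<in>N. sat U (e(v := a)) \<phi>)" by simp
    also have "\<dots> \<longleftrightarrow> sat U e (Ex v \<phi>)" using wit[of \<phi> e v] Ex.prems by auto
    finally show ?case .
  qed auto
  then show ?thesis using assms(1,2) by (auto simp: elem_sub_def)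
qed

lemma infinite_Field_if_uncountable:
  assumes "Card_order \<kappa>" "natLeq <o \<kappa>"
  shows "infinite (Field \<kappa>)"
proof -
  have "natLeq \<le>o |Field \<kappa>|"
    using ordLess_imp_ordLeq[OF assms(2)] ordIso_symmetric[OF card_of_Field_ordIso[OF assms(1)]]
    by (rule ordLeq_ordIso_trans)
  then show ?thesis using infinite_iff_natLeq_ordLeq by blast
qed

text \<open>Downward Loewenheim-Skolem. The set is closed under the functions of \<open>U\<close> and under one Skolem
function for each of the countably many formulas and each variable.\<close>

lemma small_model_above:
  fixes U :: "('f, 'r, 'a) struct" and \<kappa> :: "'k rel"
  assumes L: "countable_lang U" and \<kappa>: "Card_order \<kappa>" "natLeq <o \<kappa>" and A: "|A| <o \<kappa>"
  obtains N where "A \<subseteq> N" "small_model \<kappa> U N"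
proof -
  \<comment> \<open>A Skolem function takes a finite list of arguments, which gives the values of an initial segment
    of the variables.\<close>
  define env :: "'a list \<Rightarrow> nat \<Rightarrow> 'a" where "env as i = (if i < length as then as ! i else undefined)" for as i
  define wit where "wit = (\<lambda>(\<phi> :: ('f, 'r, 'a) fm, v) as. SOME b. sat U ((env as)(v := b)) \<phi>)"
  let ?\<Phi> = "{\<phi> :: ('f, 'r, 'a) fm. wf_fm U \<phi> \<and> params \<phi> = {}}"
  define K where "K = fun_int U ` funs U \<union> wit ` (?\<Phi> \<times> UNIV)"
  have "countable K"
    using L countable_formulas[OF L] unfolding K_def
    by (intro countable_Un countable_image countable_SIGMA) (auto simp: countable_lang_def)
  then obtain N where N: "A \<subseteq> N" "|N| \<le>o |A <+> (UNIV :: nat set)|"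
    and closed: "\<And>f as. f \<in> K \<Longrightarrow> set as \<subseteq> N \<Longrightarrow> f as \<in> N"
    using closure_under_countably_many_operations by blast
  have "elem_sub U N"
  proof (rule Tarski_Vaught)
    have "(tautology, 0) \<in> ?\<Phi> \<times> (UNIV :: nat set)" by (simp add: tautology_def)
    then have "wit (tautology, 0) \<in> K" unfolding K_def by blast
    then show "N \<noteq> {}" using closed[of _ "[]"] by fastforce
    show "fun_int U f as \<in> N" if "f \<in> funs U" "set as \<subseteq> N" for f as
      using closed[of "fun_int U f" as] that unfolding K_def by blast
    fix \<phi> :: "('f, 'r, 'a) fm" and v e a
    assume \<phi>: "wf_fm U \<phi>" "params \<phi> = {}" and e: "range e \<subseteq> N" and sat: "sat U (e(v := a)) \<phi>"
    have "\<exists>k. \<forall>i\<in>fv \<phi>. i < k" using finite_fv[of \<phi>] finite_nat_set_iff_bounded by simp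
    then obtain k where k: "\<forall>i\<in>fv \<phi>. i < k" ..
    define as where "as = map e [0..<k]"
    have same: "sat U ((env as)(v := b)) \<phi> \<longleftrightarrow> sat U (e(v := b)) \<phi>" for b
      using k by (intro sat_in_cong) (auto simp: env_def as_def)
    have "(\<phi>, v) \<in> ?\<Phi> \<times> UNIV" using \<phi> by simp
    then have "wit (\<phi>, v) \<in> K" unfolding K_def by blast
    moreover have "set as \<subseteq> N" using e by (auto simp: as_def)
    ultimately have "wit (\<phi>, v) as \<in> N" by (rule closed)
    moreover have "sat U ((env as)(v := wit (\<phi>, v) as)) \<phi>"
      unfolding wit_def prod.case by (rule someI[of _ a]) (simp only: same sat)
    ultimately show "\<exists>b\<in>N. sat U (e(v := b)) \<phi>" using same by blast
  qed
  moreover have "|N| <o \<kappa>"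
  proof -
    have "|UNIV :: nat set| <o \<kappa>" using card_of_nat \<kappa>(2) by (rule ordIso_ordLess_trans)
    then have "|A <+> (UNIV :: nat set)| <o \<kappa>"
      using \<kappa> A by (intro card_of_Plus_ordLess_infinite_Field infinite_Field_if_uncountable)
    then show ?thesis using N(2) ordLeq_ordLess_trans by blast
  qed
  ultimately show ?thesis using N(1) that by (auto simp: small_model_def)
qed

section \<open>Averages\<close>

text \<open>The integral against the uniform measure on the entries of a list; unlike \<open>Av\<close>, it applies to
arbitrary functions.\<close>

definition avg :: "('b \<Rightarrow> real) \<Rightarrow> 'b list \<Rightarrow> real" where
  "avg f as = (\<Sum>a\<leftarrow>as. f a) / real (length as)"

lemma avg_cong: "(\<And>a. a \<in> set as \<Longrightarrow> f a = g a) \<Longrightarrow> avg f as = avg g as"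
  unfolding avg_def by (metis map_eq_conv)

lemma avg_zero [simp]: "avg (\<lambda>_. 0) as = 0"
  by (simp add: avg_def)

lemma avg_add_mult: "avg (\<lambda>a. f a + r * g a) as = avg f as + r * avg g as"
  by (simp add: avg_def sum_list_addf sum_list_const_mult add_divide_distrib)

lemma avg_diff_le:
  assumes "\<And>a. a \<in> set as \<Longrightarrow> \<bar>f a - g a\<bar> \<le> \<epsilon>" "0 \<le> \<epsilon>"
  shows "\<bar>avg f as - avg g as\<bar> \<le> \<epsilon>"
proof -
  have "\<bar>(\<Sum>a\<leftarrow>as. f a) - (\<Sum>a\<leftarrow>as. g a)\<bar> \<le> real (length as) * \<epsilon>"
    using assms(1)
  proof (induction as)
    case (Cons a as)
    then have "\<bar>(\<Sum>a\<leftarrow>as. f a) - (\<Sum>a\<leftarrow>as. g a)\<bar> \<le> real (length as) * \<epsilon>" "\<bar>f a - g a\<bar> \<le> \<epsilon>" by auto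
    then show ?case by (simp add: algebra_simps)
  qed simp
  then show ?thesis
    using assms(2) by (cases "as = []") (simp_all add: avg_def field_simps abs_divide flip: diff_divide_distrib)
qed

lemma avg_indicator_bounds: "0 \<le> avg (\<lambda>a. indicator (A a) p) as \<and> avg (\<lambda>a. indicator (A a) p) as \<le> 1"
proof -
  have "0 \<le> (\<Sum>a\<leftarrow>as. indicator (A a) p :: real) \<and> (\<Sum>a\<leftarrow>as. indicator (A a) p :: real) \<le> real (length as)"
    by (induction as) (auto simp: indicator_def)
  then show ?thesis by (cases "as = []") (auto simp: avg_def)
qed

lemma borel_measurable_avg_indicator:
  assumes "\<And>a. a \<in> set as \<Longrightarrow> A a \<in> sets m"
  shows "(\<lambda>p. avg (\<lambda>a. indicator (A a) p) as) \<in> borel_measurable m"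
proof -
  have "(\<lambda>p. \<Sum>a\<leftarrow>as. indicator (A a) p :: real) \<in> borel_measurable m"
    using assms by (induction as) auto
  then show ?thesis unfolding avg_def by measurable
qed

lemma integral_avg_indicator:
  assumes m: "finite_measure m" and A: "\<And>a. a \<in> set as \<Longrightarrow> A a \<in> sets m"
  shows "(\<integral>p. avg (\<lambda>a. indicator (A a) p) as \<partial>m) = avg (\<lambda>a. measure m (A a)) as"
proof -
  interpret finite_measure m by fact
  have "integrable m (\<lambda>p. \<Sum>a\<leftarrow>as. indicator (A a) p :: real) \<and>
    (\<integral>p. (\<Sum>a\<leftarrow>as. indicator (A a) p :: real) \<partial>m) = (\<Sum>a\<leftarrow>as. measure m (A a))"
    using A
  proof (induction as)
    case (Cons a as)
    have "integrable m (indicator (A a) :: _ \<Rightarrow> real)"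
      using Cons.prems by (intro integrable_real_indicator) (auto simp: emeasure_eq_measure)
    moreover have "(\<integral>p. indicator (A a) p \<partial>m) = measure m (A a)"
      using Cons.prems sets.sets_into_space[of "A a" m] by (simp add: Int_absorb2)
    ultimately show ?case using Cons by simp
  qed simp
  then show ?thesis by (simp add: avg_def)
qed

lemma Av_eq_avg:
  assumes "\<psi> \<in> forms U x UNIV"
  shows "Av U x as \<psi> = avg (\<lambda>a. of_bool (holds U (inst x a \<psi>))) as"
proof -
  have "(\<Sum>a\<leftarrow>as. of_bool (holds U (inst x a \<psi>)) :: real) = real (length (filter (\<lambda>a. holds U (inst x a \<psi>)) as))"
    by (induction as) auto
  then show ?thesis using assms by (simp add: Av_def avg_def length_filter_conv_card)
qed

section \<open>Sequentially approximated measures\<close>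

text \<open>The content of sequential approximation, with the topology of the space of measures unfolded and
the averages written as averages of functions.\<close>

definition approximates ::
  "('f, 'r, 'a) struct \<Rightarrow> nat list \<Rightarrow> 'a set \<Rightarrow> (nat \<Rightarrow> 'a list list) \<Rightarrow> (('f, 'r, 'a) fm \<Rightarrow> real) \<Rightarrow> bool" where
  "approximates U x M a \<mu> \<longleftrightarrow> (\<forall>i. set (a i) \<subseteq> tuples x M) \<and>
     (\<forall>\<psi>\<in>forms U x UNIV. (\<lambda>i. avg (\<lambda>b. of_bool (holds U (inst x b \<psi>))) (a i)) \<longlonglongrightarrow> \<mu> \<psi>)"

lemma sequentially_approximated_approximates:
  assumes "sequentially_approximated \<kappa> U x \<mu>"
  shows "\<exists>M a. small_model \<kappa> U M \<and> approximates U x M a \<mu>"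
proof -
  obtain M a where M: "small_model \<kappa> U M" and a: "\<forall>i. a i \<noteq> [] \<and> set (a i) \<subseteq> tuples x M"
    and lim: "limitin (keisler_space U x UNIV) (\<lambda>i. Av U x (a i)) \<mu> sequentially"
    using assms unfolding sequentially_approximated_def by blast
  have "limitin (product_topology (\<lambda>_. euclideanreal) (forms U x UNIV)) (\<lambda>i. Av U x (a i)) \<mu> sequentially"
    using lim unfolding keisler_space_def limitin_subtopology by blast
  then have "\<forall>\<psi>\<in>forms U x UNIV. (\<lambda>i. Av U x (a i) \<psi>) \<longlonglongrightarrow> \<mu> \<psi>"
    unfolding limitin_componentwise by simp
  then have "approximates U x M a \<mu>" using a by (simp add: approximates_def Av_eq_avg)
  then show ?thesis using M by blast
qed

lemma approximates_mono: "approximates U x M a \<mu> \<Longrightarrow> M \<subseteq> N \<Longrightarrow> approximates U x N a \<mu>"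
  unfolding approximates_def tuples_def by blast

lemma swap_in_forms:
  assumes "\<phi> \<in> forms U (x @ y) N" "a \<in> tuples x N"
  shows "inst x a \<phi> \<in> forms U y N"
  using inst_in_forms[OF assms, of y N] by auto

text \<open>Exchanging the two substitutions shows that the truth of \<open>\<phi>(c, b)\<close>, for \<open>c\<close> from \<open>M\<close>, is decided by
the type of \<open>b\<close> over \<open>M\<close>. Hence so is the limit, which gives invariance.\<close>

lemma approximates_inst:
  assumes ap: "approximates U x M a \<mu>" and xy: "set x \<inter> set y = {}"
    and \<phi>: "\<phi> \<in> forms U (x @ y) M" and b: "b \<in> tuples y UNIV"
  shows "(\<lambda>i. avg (\<lambda>c. of_bool (inst x c \<phi> \<in> tp U y M b)) (a i)) \<longlonglongrightarrow> \<mu> (inst y b \<phi>)"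
proof -
  have "inst y b \<phi> \<in> forms U x UNIV" using inst_in_forms[OF \<phi> b, of x UNIV] by auto
  then have lim: "(\<lambda>i. avg (\<lambda>c. of_bool (holds U (inst x c (inst y b \<phi>)))) (a i)) \<longlonglongrightarrow> \<mu> (inst y b \<phi>)"
    using ap unfolding approximates_def by blast
  have "avg (\<lambda>c. of_bool (holds U (inst x c (inst y b \<phi>)))) (a i) =
      avg (\<lambda>c. of_bool (inst x c \<phi> \<in> tp U y M b)) (a i)" for i
  proof (rule avg_cong)
    fix c assume "c \<in> set (a i)"
    then have c: "c \<in> tuples x M" using ap unfolding approximates_def by blast
    have "inst x c (inst y b \<phi>) = inst y b (inst x c \<phi>)"
      using b c xy by (intro inst_commute) (auto simp: tuples_def)
    then show "(of_bool (holds U (inst x c (inst y b \<phi>))) :: real) = of_bool (inst x c \<phi> \<in> tp U y M b)"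
      using in_tp_iff[OF swap_in_forms[OF \<phi> c], of b] by simp
  qed
  with lim show ?thesis by simp
qed

lemma approximates_fiber:
  assumes ap: "approximates U x M a \<mu>" and sat: "saturated \<kappa> U" "|M| <o \<kappa>"
    and d: "distinct y" "set x \<inter> set y = {}" and \<phi>: "\<phi> \<in> forms U (x @ y) M" and q: "q \<in> types U y M"
  shows "(\<lambda>i. avg (\<lambda>c. indicator (type_cyl U y M (inst x c \<phi>)) q) (a i)) \<longlonglongrightarrow> fiber U y \<mu> \<phi> q"
proof -
  let ?b = "SOME b. realizes U y b q"
  have b: "realizes U y ?b q" using saturated_realizes[OF sat d(1) q] by (rule someI_ex)
  have "?b \<in> tuples y UNIV" using b unfolding realizes_def by blast
  from approximates_inst[OF ap d(2) \<phi> this] show ?thesis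
    unfolding realizes_tp_eq[OF q b] fiber_def using q
    by (simp add: type_cyl_def indicator_def of_bool_def)
qed

lemma type_cyl_inst_measurable:
  assumes "approximates U x M a \<mu>" "\<phi> \<in> forms U (x @ y) M" "c \<in> set (a i)"
  shows "type_cyl U y M (inst x c \<phi>) \<in> sets (borel_sets (type_space U y M))"
proof -
  have "c \<in> tuples x M" using assms(1,3) unfolding approximates_def by blast
  then show ?thesis using assms(2) by (intro openin_in_borel_sets openin_type_cyl swap_in_forms)
qed

text \<open>The fibers are pointwise limits of sequences of averages of indicators of clopen sets.\<close>

lemma approximates_borel_definable:
  fixes U :: "('f, 'r, 'a) struct"
  assumes M: "small_model \<kappa> U M" and ap: "approximates U x M a \<mu>" and sat: "saturated \<kappa> U"
  shows "borel_definable_over \<kappa> U x M \<mu>"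
  unfolding borel_definable_over_def
proof (intro conjI M allI impI)
  have sM: "|M| <o \<kappa>" using M by (simp add: small_model_def)
  show "invariant U x M \<mu>"
    unfolding invariant_def
  proof (intro allI impI)
    fix y and \<phi> :: "('f, 'r, 'a) fm" and b b'
    assume h: "distinct y \<and> set x \<inter> set y = {} \<and> \<phi> \<in> forms U (x @ y) {} \<and>
      b \<in> tuples y UNIV \<and> b' \<in> tuples y UNIV \<and> tp U y M b = tp U y M b'"
    then have \<phi>: "\<phi> \<in> forms U (x @ y) M" by (auto simp: forms_def)
    have "(\<lambda>i. avg (\<lambda>c. of_bool (inst x c \<phi> \<in> tp U y M b)) (a i)) \<longlonglongrightarrow> \<mu> (inst y b \<phi>)"
      using h by (intro approximates_inst[OF ap _ \<phi>]) auto
    moreover have "(\<lambda>i. avg (\<lambda>c. of_bool (inst x c \<phi> \<in> tp U y M b')) (a i)) \<longlonglongrightarrow> \<mu> (inst y b' \<phi>)"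
      using h by (intro approximates_inst[OF ap _ \<phi>]) auto
    moreover have "tp U y M b = tp U y M b'" using h by blast
    ultimately show "\<mu> (inst y b \<phi>) = \<mu> (inst y b' \<phi>)" by (simp add: LIMSEQ_unique)
  qed
  fix y and \<phi> :: "('f, 'r, 'a) fm" assume h: "distinct y \<and> set x \<inter> set y = {} \<and> \<phi> \<in> forms U (x @ y) {}"
  then have d: "distinct y" "set x \<inter> set y = {}" and \<phi>: "\<phi> \<in> forms U (x @ y) M" by (auto simp: forms_def)
  show "fiber U y \<mu> \<phi> \<in> borel_measurable (borel_sets (type_space U y M))"
  proof (rule borel_measurable_LIMSEQ_real)
    show "(\<lambda>q. avg (\<lambda>c. indicator (type_cyl U y M (inst x c \<phi>)) q) (a i))
        \<in> borel_measurable (borel_sets (type_space U y M))" for i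
      by (intro borel_measurable_avg_indicator type_cyl_inst_measurable[OF ap \<phi>])
    show "(\<lambda>i. avg (\<lambda>c. indicator (type_cyl U y M (inst x c \<phi>)) q) (a i)) \<longlonglongrightarrow> fiber U y \<mu> \<phi> q"
      if "q \<in> space (borel_sets (type_space U y M))" for q
      using that by (intro approximates_fiber[OF ap sat sM d \<phi>]) simp
  qed
qed

lemma type_measure_basics:
  assumes "\<mu> \<in> keisler U x UNIV"
  shows "prob_space (type_measure U x N \<mu>)"
    and "sets (type_measure U x N \<mu>) = sets (borel_sets (type_space U x N))"
    and "space (type_measure U x N \<mu>) = types U x N"
proof -
  show "prob_space (type_measure U x N \<mu>)"
    and s: "sets (type_measure U x N \<mu>) = sets (borel_sets (type_space U x N))"
    using type_measure_spec(1)[OF assms, of N] by (auto simp: regular_borel_prob_def)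
  show "space (type_measure U x N \<mu>) = types U x N"
    using sets_eq_imp_space_eq[OF s] by simp
qed

text \<open>The integral of an average of indicators of the cylinders of \<open>\<phi>(c, y)\<close> is the average of the numbers
\<open>\<nu>(\<phi>(c, y))\<close>, and the indicator averages converge pointwise to the fiber, bounded by 1.\<close>

lemma avg_tends_to_fiber_integral:
  assumes M: "small_model \<kappa> U M" and ap: "approximates U x M a \<mu>" and sat: "saturated \<kappa> U"
    and d: "distinct y" "set x \<inter> set y = {}" and \<phi>: "\<phi> \<in> forms U (x @ y) M"
    and \<nu>: "\<nu> \<in> keisler U y UNIV"
  shows "(\<lambda>i. avg (\<lambda>c. \<nu> (inst x c \<phi>)) (a i)) \<longlonglongrightarrow> (\<integral>q. fiber U y \<mu> \<phi> q \<partial>type_measure U y M \<nu>)"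
proof -
  let ?m = "type_measure U y M \<nu>"
  let ?g = "\<lambda>i q. avg (\<lambda>c. indicator (type_cyl U y M (inst x c \<phi>)) q) (a i)"
  interpret prob_space ?m by (rule type_measure_basics(1)[OF \<nu>])
  have sM: "|M| <o \<kappa>" using M by (simp add: small_model_def)
  have cyl: "type_cyl U y M (inst x c \<phi>) \<in> sets ?m" if "c \<in> set (a i)" for c i
    using type_cyl_inst_measurable[OF ap \<phi> that] type_measure_basics(2)[OF \<nu>] by simp
  have lim: "(\<lambda>i. ?g i q) \<longlonglongrightarrow> fiber U y \<mu> \<phi> q" if "q \<in> space ?m" for q
    using that type_measure_basics(3)[OF \<nu>] by (intro approximates_fiber[OF ap sat sM d \<phi>]) simp
  have g: "?g i \<in> borel_measurable ?m" for i
    by (intro borel_measurable_avg_indicator cyl)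
  have f: "fiber U y \<mu> \<phi> \<in> borel_measurable ?m"
    using lim g by (rule_tac borel_measurable_LIMSEQ_real)
  have "(\<lambda>i. \<integral>q. ?g i q \<partial>?m) \<longlonglongrightarrow> (\<integral>q. fiber U y \<mu> \<phi> q \<partial>?m)"
  proof (rule integral_dominated_convergence[where w = "\<lambda>_. 1"])
    show "AE q in ?m. (\<lambda>i. ?g i q) \<longlonglongrightarrow> fiber U y \<mu> \<phi> q" using lim by (intro AE_I2)
    show "AE q in ?m. norm (?g i q) \<le> 1" for i
      by (intro AE_I2) (simp add: avg_indicator_bounds)
  qed (use f g in auto)
  moreover have "(\<integral>q. ?g i q \<partial>?m) = avg (\<lambda>c. \<nu> (inst x c \<phi>)) (a i)" for i
  proof -
    have "(\<integral>q. ?g i q \<partial>?m) = avg (\<lambda>c. measure ?m (type_cyl U y M (inst x c \<phi>))) (a i)"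
      by (intro integral_avg_indicator finite_measure_axioms cyl)
    also have "\<dots> = avg (\<lambda>c. \<nu> (inst x c \<phi>)) (a i)"
    proof (rule avg_cong)
      fix c assume "c \<in> set (a i)"
      then have "c \<in> tuples x M" using ap unfolding approximates_def by blast
      then show "measure ?m (type_cyl U y M (inst x c \<phi>)) = \<nu> (inst x c \<phi>)"
        using \<phi> by (intro type_measure_spec(2)[OF \<nu>] swap_in_forms)
    qed
    finally show ?thesis .
  qed
  ultimately show ?thesis by simp
qed

lemma avg_step_fun_tends_to_integral:
  assumes ap: "approximates U x M a \<mu>" and \<mu>: "\<mu> \<in> keisler U x UNIV"
    and h: "step_fun (type_cyl U x N ` forms U x N) h"
  shows "integrable (type_measure U x N \<mu>) h \<and>
    (\<lambda>i. avg (\<lambda>c. h (tp U x N c)) (a i)) \<longlonglongrightarrow> (\<integral>p. h p \<partial>type_measure U x N \<mu>)"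
  using h
proof induction
  case zero
  then show ?case by simp
next
  case (add h A r)
  let ?m = "type_measure U x N \<mu>"
  interpret prob_space ?m by (rule type_measure_basics(1)[OF \<mu>])
  obtain \<psi> where \<psi>: "\<psi> \<in> forms U x N" "A = type_cyl U x N \<psi>" using add.hyps by blast
  have A: "A \<in> sets ?m"
    using \<psi> type_measure_basics(2)[OF \<mu>] by (auto intro: openin_type_cyl)
  have iA: "integrable ?m (indicator A :: _ \<Rightarrow> real)"
    using A by (intro integrable_real_indicator) (auto simp: emeasure_eq_measure)
  have "(\<integral>p. indicator A p \<partial>?m) = measure ?m A"
    using sets.sets_into_space[OF A] by (simp add: Int_absorb2)
  also have "\<dots> = \<mu> \<psi>" using \<psi> type_measure_spec(2)[OF \<mu>] by simp
  finally have int: "(\<integral>p. h p + r * indicator A p \<partial>?m) = (\<integral>p. h p \<partial>?m) + r * \<mu> \<psi>"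
    using add.IH iA by simp
  have "avg (\<lambda>c. indicator A (tp U x N c)) (a i) = avg (\<lambda>c. of_bool (holds U (inst x c \<psi>))) (a i)" for i
  proof (rule avg_cong)
    fix c assume "c \<in> set (a i)"
    then have "c \<in> tuples x M" using ap unfolding approximates_def by blast
    then have "tp U x N c \<in> types U x N" by (intro tp_in_types) (simp add: tuples_def)
    then show "indicator A (tp U x N c) = (of_bool (holds U (inst x c \<psi>)) :: real)"
      using \<psi> in_tp_iff[OF \<psi>(1), of c] by (simp add: type_cyl_def indicator_def)
  qed
  moreover have "(\<lambda>i. avg (\<lambda>c. of_bool (holds U (inst x c \<psi>))) (a i)) \<longlonglongrightarrow> \<mu> \<psi>"
    using ap forms_UNIV[OF \<psi>(1)] unfolding approximates_def by blast
  ultimately have "(\<lambda>i. avg (\<lambda>c. indicator A (tp U x N c)) (a i)) \<longlonglongrightarrow> \<mu> \<psi>" by simp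
  then have "(\<lambda>i. avg (\<lambda>c. h (tp U x N c)) (a i) + r * avg (\<lambda>c. indicator A (tp U x N c)) (a i))
      \<longlonglongrightarrow> (\<integral>p. h p \<partial>?m) + r * \<mu> \<psi>"
    using add.IH by (intro tendsto_add tendsto_mult tendsto_const) auto
  then show ?case using add.IH iA by (simp add: avg_add_mult int)
qed

text \<open>Convergence on cylinders is the hypothesis of approximation; linear combinations and uniform limits
extend it to continuous functions.\<close>

lemma avg_continuous_tends_to_integral:
  assumes ap: "approximates U x M a \<mu>" and \<mu>: "\<mu> \<in> keisler U x UNIV"
    and cont: "continuous_map (type_space U x N) euclideanreal f"
  shows "(\<lambda>i. avg (\<lambda>c. f (tp U x N c)) (a i)) \<longlonglongrightarrow> (\<integral>p. f p \<partial>type_measure U x N \<mu>)"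
proof (rule LIMSEQ_I)
  let ?m = "type_measure U x N \<mu>"
  interpret prob_space ?m by (rule type_measure_basics(1)[OF \<mu>])
  interpret B: clopen_basis "type_space U x N" "type_cyl U x N ` forms U x N"
    by (rule clopen_basis_type_space)
  have f: "f \<in> borel_measurable ?m"
    using continuous_map_real_measurable_borel_sets[OF cont] measurable_cong_sets[OF type_measure_basics(2)[OF \<mu>] refl]
    by blast
  fix e :: real assume "0 < e"
  then have "0 < e / 3" by simp
  then obtain h where h: "step_fun (type_cyl U x N ` forms U x N) h"
    and fh': "\<And>p. p \<in> topspace (type_space U x N) \<Longrightarrow> \<bar>f p - h p\<bar> < e / 3"
    using B.continuous_step_approx[OF cont] by blast
  have fh: "\<bar>f p - h p\<bar> \<le> e / 3" if "p \<in> types U x N" for p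
    by (rule less_imp_le, rule fh') (simp add: that)
  have ih: "integrable ?m h" and lim: "(\<lambda>i. avg (\<lambda>c. h (tp U x N c)) (a i)) \<longlonglongrightarrow> (\<integral>p. h p \<partial>?m)"
    using avg_step_fun_tends_to_integral[OF ap \<mu> h] by auto
  have idiff: "integrable ?m (\<lambda>p. f p - h p)"
    using f ih fh type_measure_basics(3)[OF \<mu>]
    by (intro integrable_const_bound[where B = "e / 3"] AE_I2) auto
  then have "integrable ?m (\<lambda>p. (f p - h p) + h p)" using ih by (intro Bochner_Integration.integrable_add)
  then have if': "integrable ?m f" by simp
  have "\<bar>\<integral>p. f p - h p \<partial>?m\<bar> \<le> (\<integral>p. \<bar>f p - h p\<bar> \<partial>?m)" by (rule integral_abs_bound)
  also have "\<dots> \<le> (\<integral>p. e / 3 \<partial>?m)"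
    using idiff fh type_measure_basics(3)[OF \<mu>] by (intro integral_mono) auto
  also have "\<dots> = e / 3" by (simp add: prob_space)
  finally have 1: "\<bar>(\<integral>p. f p \<partial>?m) - (\<integral>p. h p \<partial>?m)\<bar> \<le> e / 3" using if' ih by simp
  have 2: "\<bar>avg (\<lambda>c. f (tp U x N c)) (a i) - avg (\<lambda>c. h (tp U x N c)) (a i)\<bar> \<le> e / 3" for i
  proof (rule avg_diff_le)
    fix c assume "c \<in> set (a i)"
    then have "c \<in> tuples x M" using ap unfolding approximates_def by blast
    then have "tp U x N c \<in> types U x N" by (intro tp_in_types) (simp add: tuples_def)
    then show "\<bar>f (tp U x N c) - h (tp U x N c)\<bar> \<le> e / 3" by (rule fh)
  qed (use \<open>0 < e\<close> in simp)
  obtain n where n: "\<forall>i\<ge>n. norm (avg (\<lambda>c. h (tp U x N c)) (a i) - (\<integral>p. h p \<partial>?m)) < e / 3"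
    using LIMSEQ_D[OF lim \<open>0 < e / 3\<close>] ..
  have "norm (avg (\<lambda>c. f (tp U x N c)) (a i) - (\<integral>p. f p \<partial>?m)) < e" if "n \<le> i" for i
    using n[rule_format, OF that] 1 2[of i] unfolding real_norm_def by linarith
  then show "\<exists>n. \<forall>i\<ge>n. norm (avg (\<lambda>c. f (tp U x N c)) (a i) - (\<integral>p. f p \<partial>?m)) < e" by blast
qed

text \<open>Both integrals are the limit of the averages of the \<open>\<nu>(\<phi>(c, y))\<close> over the approximating points \<open>c\<close>:
the right one because these averages are averages of the fiber of \<open>\<nu>\<close> over the types of the points.\<close>

lemma fiber_integrals_commute:
  assumes M: "small_model \<kappa> U M" and ap: "approximates U x M a \<mu>" and df: "definable_over \<kappa> U y M' \<nu>" "M' \<subseteq> M"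
    and sat: "saturated \<kappa> U"
    and d: "distinct x" "distinct y" "set x \<inter> set y = {}" and \<phi>: "\<phi> \<in> forms U (x @ y) M"
    and \<mu>: "\<mu> \<in> keisler U x UNIV" and \<nu>: "\<nu> \<in> keisler U y UNIV"
  shows "(\<integral>q. fiber U y \<mu> \<phi> q \<partial>type_measure U y M \<nu>) = (\<integral>p. fiber U x \<nu> \<phi> p \<partial>type_measure U x M \<mu>)"
proof -
  have sM: "|M| <o \<kappa>" using M by (simp add: small_model_def)
  have \<phi>': "\<phi> \<in> forms U (y @ x) M" using \<phi> by (auto simp: forms_def)
  have d': "set y \<inter> set x = {}" using d(3) by auto
  have "continuous_map (type_space U x M) euclideanreal (fiber U x \<nu> \<phi>)"
    by (rule fiber_continuous[OF df sat sM d(1) d' \<phi>'])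
  from avg_continuous_tends_to_integral[OF ap \<mu> this]
  have "(\<lambda>i. avg (\<lambda>c. fiber U x \<nu> \<phi> (tp U x M c)) (a i)) \<longlonglongrightarrow> (\<integral>p. fiber U x \<nu> \<phi> p \<partial>type_measure U x M \<mu>)" .
  moreover have "avg (\<lambda>c. fiber U x \<nu> \<phi> (tp U x M c)) (a i) = avg (\<lambda>c. \<nu> (inst x c \<phi>)) (a i)" for i
  proof (rule avg_cong)
    fix c assume "c \<in> set (a i)"
    then have "c \<in> tuples x M" using ap unfolding approximates_def by blast
    then have len: "length c = length x" by (simp add: tuples_def)
    have inv: "invariant U y M' \<nu>" using df(1) by (simp add: definable_over_def)
    show "fiber U x \<nu> \<phi> (tp U x M c) = \<nu> (inst x c \<phi>)"
      by (rule fiber_eq[OF inv df(2) d(1) d' \<phi>' tp_in_types[OF len] realizes_tp[OF len]])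
  qed
  ultimately have "(\<lambda>i. avg (\<lambda>c. \<nu> (inst x c \<phi>)) (a i)) \<longlonglongrightarrow> (\<integral>p. fiber U x \<nu> \<phi> p \<partial>type_measure U x M \<mu>)"
    by simp
  with avg_tends_to_fiber_integral[OF M ap sat d(2,3) \<phi> \<nu>] show ?thesis by (rule LIMSEQ_unique)
qed

section \<open>The Morley product over a large model\<close>

text \<open>The model selected by the choice operator in the definition may be replaced by any larger small
set; this is what lets the two products be computed over the same model.\<close>

lemma morley_product_over:
  assumes L: "countable_lang U" and \<kappa>: "Card_order \<kappa>" "natLeq <o \<kappa>" and sat: "saturated \<kappa> U"
    and bd: "borel_definable_over \<kappa> U x M \<mu>" and d: "distinct y" "set x \<inter> set y = {}"
    and \<phi>: "\<phi> \<in> forms U (x @ y) UNIV" and \<nu>: "\<nu> \<in> keisler U y UNIV"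
  obtains N where "params \<phi> \<subseteq> N" "small_model \<kappa> U N"
    "\<forall>N'. N \<subseteq> N' \<and> |N'| <o \<kappa> \<longrightarrow>
      morley_product \<kappa> U x y \<mu> \<nu> \<phi> = (\<integral>q. fiber U y \<mu> \<phi> q \<partial>type_measure U y N' \<nu>)"
proof -
  let ?P = "\<lambda>N. small_model \<kappa> U N \<and> params \<phi> \<subseteq> N \<and> (\<exists>M\<subseteq>N. borel_definable_over \<kappa> U x M \<mu>)"
  have inf: "infinite (Field \<kappa>)" using \<kappa> by (rule infinite_Field_if_uncountable)
  have "|M| <o \<kappa>" using bd by (simp add: borel_definable_over_def small_model_def)
  moreover have "|params \<phi>| <o \<kappa>"
    using finite_params[of \<phi>] \<kappa>(2) by (auto simp: finite_iff_ordLess_natLeq intro: ordLess_transitive)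
  ultimately have "|M \<union> params \<phi>| <o \<kappa>" using inf \<kappa>(1) by (intro card_of_Un_ordLess_infinite_Field)
  then obtain N\<^sub>0 where "M \<union> params \<phi> \<subseteq> N\<^sub>0" "small_model \<kappa> U N\<^sub>0"
    using small_model_above[OF L \<kappa>] by blast
  then have "?P N\<^sub>0" using bd by blast
  then have N: "?P (SOME N. ?P N)" by (rule someI)
  define N where "N = (SOME N. ?P N)"
  obtain M\<^sub>1 where M\<^sub>1: "M\<^sub>1 \<subseteq> N" "borel_definable_over \<kappa> U x M\<^sub>1 \<mu>" using N unfolding N_def by blast
  have "params \<phi> \<subseteq> N" "small_model \<kappa> U N" using N unfolding N_def by blast+
  then have \<phi>N: "\<phi> \<in> forms U (x @ y) N" using \<phi> by (auto simp: forms_def)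
  have "morley_product \<kappa> U x y \<mu> \<nu> \<phi> = (\<integral>q. fiber U y \<mu> \<phi> q \<partial>type_measure U y N \<nu>)"
    using \<phi> by (simp add: morley_product_def N_def)
  then have "\<forall>N'. N \<subseteq> N' \<and> |N'| <o \<kappa> \<longrightarrow>
      morley_product \<kappa> U x y \<mu> \<nu> \<phi> = (\<integral>q. fiber U y \<mu> \<phi> q \<partial>type_measure U y N' \<nu>)"
    using fiber_integral_indep[OF M\<^sub>1(2,1) _ sat _ d \<phi>N \<nu>] by simp
  then show ?thesis using \<open>params \<phi> \<subseteq> N\<close> \<open>small_model \<kappa> U N\<close> by (rule_tac that)
qed

theorem proposition3p7:
  fixes U :: "('f, 'r, 'a) struct" and T :: "('f, 'r, 'a) fm set" and \<kappa> :: "'k rel"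
    and x y :: "nat list" and \<mu> \<nu> :: "('f, 'r, 'a) fm \<Rightarrow> real"
  assumes "countable_lang U" and "complete_theory U T" and "monster_model \<kappa> T U"
    and "distinct x" and "distinct y" and "set x \<inter> set y = {}"
    and "\<mu> \<in> keisler U x UNIV" and "\<nu> \<in> keisler U y UNIV"
    and "sequentially_approximated \<kappa> U x \<mu>" and "definable \<kappa> U y \<nu>"
  shows "morley_product \<kappa> U x y \<mu> \<nu> = morley_product \<kappa> U y x \<nu> \<mu>"
proof
  fix \<phi> :: "('f, 'r, 'a) fm"
  have \<kappa>: "Card_order \<kappa>" "natLeq <o \<kappa>" and sat: "saturated \<kappa> U"
    using assms(3) by (auto simp: monster_model_def)
  have yx: "set y \<inter> set x = {}" using assms(6) by auto
  have forms_eq: "forms U (y @ x) UNIV = forms U (x @ y) (UNIV :: 'a set)" by (auto simp: forms_def)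
  show "morley_product \<kappa> U x y \<mu> \<nu> \<phi> = morley_product \<kappa> U y x \<nu> \<mu> \<phi>"
  proof (cases "\<phi> \<in> forms U (x @ y) UNIV")
    case False
    then show ?thesis by (simp add: morley_product_def forms_eq)
  next
    case \<phi>: True
    have \<phi>': "\<phi> \<in> forms U (y @ x) UNIV" using \<phi> forms_eq by blast
    obtain M a where M: "small_model \<kappa> U M" and ap: "approximates U x M a \<mu>"
      using sequentially_approximated_approximates[OF assms(9)] by blast
    obtain M' where df: "definable_over \<kappa> U y M' \<nu>" using assms(10) unfolding definable_def by blast
    obtain N\<^sub>1 where N\<^sub>1: "params \<phi> \<subseteq> N\<^sub>1" "small_model \<kappa> U N\<^sub>1" "\<forall>N'. N\<^sub>1 \<subseteq> N' \<and> |N'| <o \<kappa> \<longrightarrow>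
        morley_product \<kappa> U x y \<mu> \<nu> \<phi> = (\<integral>q. fiber U y \<mu> \<phi> q \<partial>type_measure U y N' \<nu>)"
      using morley_product_over[OF assms(1) \<kappa> sat approximates_borel_definable[OF M ap sat] assms(5,6) \<phi> assms(8)] .
    obtain N\<^sub>2 where N\<^sub>2: "params \<phi> \<subseteq> N\<^sub>2" "small_model \<kappa> U N\<^sub>2" "\<forall>N'. N\<^sub>2 \<subseteq> N' \<and> |N'| <o \<kappa> \<longrightarrow>
        morley_product \<kappa> U y x \<nu> \<mu> \<phi> = (\<integral>q. fiber U x \<nu> \<phi> q \<partial>type_measure U x N' \<mu>)"
      using morley_product_over[OF assms(1) \<kappa> sat definable_over_imp_borel[OF df] assms(4) yx \<phi>' assms(7)] .
    have "|M| <o \<kappa>" "|M'| <o \<kappa>" "|N\<^sub>1| <o \<kappa>" "|N\<^sub>2| <o \<kappa>"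
      using M df N\<^sub>1(2) N\<^sub>2(2) by (simp_all add: definable_over_def small_model_def)
    \<comment> \<open>Both products can be computed over one small model that also contains the approximating points
      and the set over which \<open>\<nu>\<close> is definable.\<close>
    then have "|M \<union> (M' \<union> (N\<^sub>1 \<union> N\<^sub>2))| <o \<kappa>"
      using \<kappa> by (intro card_of_Un_ordLess_infinite_Field infinite_Field_if_uncountable)
    then obtain N where sub: "M \<union> (M' \<union> (N\<^sub>1 \<union> N\<^sub>2)) \<subseteq> N" and N: "small_model \<kappa> U N"
      using small_model_above[OF assms(1) \<kappa>] by blast
    have sN: "|N| <o \<kappa>" using N by (simp add: small_model_def)
    have \<phi>N: "\<phi> \<in> forms U (x @ y) N" using \<phi> N\<^sub>1(1) sub by (auto simp: forms_def)
    have "M \<subseteq> N" "M' \<subseteq> N" "N\<^sub>1 \<subseteq> N" "N\<^sub>2 \<subseteq> N" using sub by auto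
    then show ?thesis
      using N\<^sub>1(3) N\<^sub>2(3) sN
        fiber_integrals_commute[OF N approximates_mono[OF ap \<open>M \<subseteq> N\<close>] df \<open>M' \<subseteq> N\<close> sat assms(4-6) \<phi>N assms(7,8)]
      by simp
  qed
qed

end
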